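(* Let $d\ge1$ be an integer, let $\mathcal{A}\subseteq\mathrm{End}(\mathbb{C}^d)$ be a von Neumann algebra and let $G_{\mathcal{A}}$ be its gauge group. In the single-copy bipartite estimation scenario with prior $p$ on density operators of $(\mathbb{C}^d)^{\otimes2}$ and parameters $\vec{\mathfrak{s}}=(\mathfrak{s}^{(1)},\dots,\mathfrak{s}^{(l)})$ (described in the context), assume that the prior $p$ and the vector of parameters $\vec{\mathfrak{s}}$ 1. have $\mathbf{Q}(G_{\mathcal{A}})=\{V^{\otimes2}:V\in G_{\mathcal{A}}\}$ as a symmetry; 2. have $\mathbf{P}(\mathcal{S}_2)=\{\mathbb{I},\mathrm{Swap}\}$ as a symmetry. Then for any given measurement with POVM $M:\sigma(\Omega)\to\mathrm{End}((\mathbb{C}^d)^{\otimes2})$, there is another measurement whose POVM is of the form $$M'=\Pi_{+}M_{+}\Pi_{+}+\Pi_{-}M_{-}\Pi_{-},$$ where $M_{\pm}:\sigma(\Omega)\to\mathcal{A}^{\otimes2}$ are POVMs, such that $$q_M(B|\vec S\in\vec\Delta)=q_{M'}(B|\vec S\in\vec\Delta)$$ for all $B\in\sigma(\Omega)$ and all $l$-dimensional intervals $\vec\Delta\subseteq\mathbb{R}^l$ which are assigned nonzero probability.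
   Context: A von Neumann algebra $\mathcal{A}\subseteq\mathrm{End}(\mathbb{C}^d)$ is a complex subalgebra containing the identity and closed under adjoint; its gauge group $G_{\mathcal{A}}$ is the group of all unitaries in $\mathrm{U}(d)$ commuting with every element of $\mathcal{A}$. $\mathrm{Swap}$ is the unitary on $(\mathbb{C}^d)^{\otimes2}$ with $\mathrm{Swap}(|\psi\rangle|\phi\rangle)=|\phi\rangle|\psi\rangle$. $\Pi_{+},\Pi_{-}$ are the orthogonal projectors onto the symmetric and antisymmetric subspaces of $(\mathbb{C}^d)^{\otimes2}$. Scenario: $d\rho$ is a fixed reference (Borel) measure on the set of density operators in $\mathrm{End}((\mathbb{C}^d)^{\otimes2})$, invariant under unitary transformations $\rho\mapsto V\rho V^\dagger$. A state $\rho$ is chosen randomly according to a probability density $p$ relative to $d\rho$, and a single system in state $\rho$ is measured. $\mathrm{supp}(p)$ is the set of states to which $p$ assigns nonzero density. The parameters are (measurable) functions $\mathfrak{s}^{(i)}:\mathrm{supp}(p)\to\mathbb{R}$, $\vec{\mathfrak{s}}=(\mathfrak{s}^{(1)},\dots,\mathfrak{s}^{(l)})$, and $\vec S=\vec{\mathfrak{s}}(\rho)$ is the induced random vector. $p$ has a group $H$ of unitaries on $(\mathbb{C}^d)^{\otimes2}$ as a symmetry if $p(V\rho V^\dagger)=p(\rho)$ for all $V\in H$ and all $\rho$; $\vec{\mathfrak{s}}$ has $H$ as a symmetry if $\vec{\mathfrak{s}}(V\rho V^\dagger)=\vec{\mathfrak{s}}(\rho)$ for all $V\in H$ and all $\rho\in\mathrm{supp}(p)$.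 A POVM with outcome space a measurable space $(\Omega,\sigma(\Omega))$ is a countably additive map $M$ from $\sigma(\Omega)$ to positive operators on $(\mathbb{C}^d)^{\otimes2}$ with $M(\Omega)$ the identity. Set $q_M(B|\rho)=\mathrm{tr}(M(B)\rho)$, $\Pr(\vec S\in\vec\Delta)=\int_{\vec{\mathfrak{s}}(\rho)\in\vec\Delta}d\rho\,p(\rho)$ and $$q_M(B|\vec S\in\vec\Delta)=\frac{1}{\Pr(\vec S\in\vec\Delta)}\int_{\vec{\mathfrak{s}}(\rho)\in\vec\Delta}d\rho\,p(\rho)\,q_M(B|\rho).$$ *)

theory Defs
  imports "HOL-Analysis.Analysis"
begin

(* Operators on C^d are matrices in the standard basis, of type complex^'d^'d; the index type 'd
   has d = CARD('d) >= 1 elements.  Vectors and operators on the tensor square of C^d are indexed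
   by 'd \<times> 'd. *)

type_synonym 'n op = "complex^'n^'n"

section \<open>Operators\<close>

definition cscale :: "complex \<Rightarrow> complex^'n^'m \<Rightarrow> complex^'n^'m" where
  "cscale c A = (\<chi> i j. c * A $ i $ j)"

interpretation cmat: vector_space "cscale :: complex \<Rightarrow> complex^'n^'m \<Rightarrow> complex^'n^'m"
  by unfold_locales (simp_all add: cscale_def vec_eq_iff algebra_simps)

definition cadjoint :: "complex^'n^'m \<Rightarrow> complex^'m^'n" where
  "cadjoint A = (\<chi> i j. cnj (A $ j $ i))"

definition unitary :: "('n::finite) op \<Rightarrow> bool" where
  "unitary V \<longleftrightarrow> V ** cadjoint V = mat 1 \<and> cadjoint V ** V = mat 1"

definition cinner :: "complex^'n \<Rightarrow> complex^'n \<Rightarrow> complex" where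
  "cinner v w = (\<Sum>i\<in>UNIV. cnj (v $ i) * w $ i)"

(* Over the complex numbers this includes self-adjointness. *)
definition positive_op :: "('n::finite) op \<Rightarrow> bool" where
  "positive_op A \<longleftrightarrow> (\<forall>v. cinner v (A *v v) \<in> \<real>\<^sub>\<ge>\<^sub>0)"

definition orth_projector :: "(complex^'n) set \<Rightarrow> ('n::finite) op" where
  "orth_projector S = (THE P. P ** P = P \<and> cadjoint P = P \<and> range ((*v) P) = S)"

definition conj_by :: "('n::finite) op \<Rightarrow> 'n op \<Rightarrow> 'n op" where
  "conj_by V \<rho> = V ** \<rho> ** cadjoint V"

section \<open>Tensor square\<close>

definition tensor_vec :: "complex^'d \<Rightarrow> complex^'d \<Rightarrow> complex^('d \<times> 'd)" where
  "tensor_vec v w = (\<chi> i. v $ fst i * w $ snd i)"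

definition tensor_op :: "('d::finite) op \<Rightarrow> 'd op \<Rightarrow> ('d \<times> 'd) op" where
  "tensor_op A B = (\<chi> i j. A $ fst i $ fst j * B $ snd i $ snd j)"

lemma tensor_op_tensor_vec:
  "tensor_op A B *v tensor_vec v w = tensor_vec (A *v v) (B *v (w :: complex^'d::finite))"
proof -
  have "(tensor_op A B *v tensor_vec v w) $ (i, j) = tensor_vec (A *v v) (B *v w) $ (i, j)" for i j
  proof -
    have "(tensor_op A B *v tensor_vec v w) $ (i, j) =
        (\<Sum>k\<in>UNIV \<times> UNIV. (A $ i $ fst k * v $ fst k) * (B $ j $ snd k * w $ snd k))"
      by (simp add: tensor_op_def tensor_vec_def matrix_vector_mult_def mult_ac)
    also have "\<dots> = (\<Sum>k\<in>UNIV. A $ i $ k * v $ k) * (\<Sum>k\<in>UNIV. B $ j $ k * w $ k)"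
      by (simp add: sum_product sum.cartesian_product' del: UNIV_Times_UNIV)
    finally show ?thesis
      by (simp add: tensor_vec_def matrix_vector_mult_def)
  qed
  then show ?thesis
    by (simp add: vec_eq_iff)
qed

definition Swap :: "('d::finite \<times> 'd) op" where
  "Swap = (\<chi> i j. if j = prod.swap i then 1 else 0)"

lemma Swap_mult_vec: "(Swap *v v) $ i = v $ prod.swap i"
  unfolding Swap_def matrix_vector_mult_def by (simp add: if_distrib if_distribR cong: if_cong)

lemma Swap_tensor_vec: "Swap *v tensor_vec v w = tensor_vec w v"
  by (simp add: vec_eq_iff Swap_mult_vec tensor_vec_def mult.commute)

definition sym_subspace :: "(complex^('d::finite \<times> 'd)) set" where
  "sym_subspace = {v. Swap *v v = v}"

definition antisym_subspace :: "(complex^('d::finite \<times> 'd)) set" where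
  "antisym_subspace = {v. Swap *v v = - v}"

definition Pi_plus :: "('d::finite \<times> 'd) op" where
  "Pi_plus = orth_projector sym_subspace"

definition Pi_minus :: "('d::finite \<times> 'd) op" where
  "Pi_minus = orth_projector antisym_subspace"

lemma orth_projector_unique:
  fixes P Q :: "('n::finite) op"
  assumes P: "P ** P = P" "cadjoint P = P" "range ((*v) P) = S"
    and Q: "Q ** Q = Q" "cadjoint Q = Q" "range ((*v) Q) = S"
  shows "P = Q"
proof -
  have absorb: "X ** Y = Y" if X: "X ** X = X" and ran: "range ((*v) X) = range ((*v) Y)"
    for X Y :: "'n op"
  proof -
    have "(X ** Y) *v v = Y *v v" for v
    proof -
      have "Y *v v \<in> range ((*v) X)"
        unfolding ran by (rule rangeI)
      then obtain w where w: "Y *v v = X *v w" ..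
      have "(X ** Y) *v v = (X ** X) *v w"
        by (simp only: w flip: matrix_vector_mul_assoc)
      also have "\<dots> = Y *v v"
        by (simp only: X w)
      finally show ?thesis .
    qed
    then show ?thesis
      by (simp only: matrix_eq) simp
  qed
  have "Q = cadjoint (P ** Q)"
    using absorb[OF P(1), of Q] P(3) Q(2,3) by simp
  also have "\<dots> = cadjoint Q ** cadjoint P"
    by (simp add: cadjoint_def matrix_matrix_mult_def vec_eq_iff mult.commute)
  also have "\<dots> = P"
    using absorb[OF Q(1), of P] P(2,3) Q(2,3) by simp
  finally show ?thesis ..
qed

lemma orth_projector_eqI:
  assumes "P ** P = P" "cadjoint P = P" "range ((*v) P) = S"
  shows "orth_projector S = P"
  unfolding orth_projector_def
proof (rule the_equality)
  show "P ** P = P \<and> cadjoint P = P \<and> range ((*v) P) = S"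
    using assms by simp
  show "Q = P" if "Q ** Q = Q \<and> cadjoint Q = Q \<and> range ((*v) Q) = S" for Q
    using that assms orth_projector_unique[of Q S P] by simp
qed

lemma cscale_mult_vec: "cscale c A *v v = c *s (A *v v)"
  by (simp add: cscale_def matrix_vector_mult_def vec_eq_iff sum_distrib_left mult_ac)

lemma half_Swap_projector:
  fixes c :: complex
  assumes c: "c = 1 \<or> c = -1"
  shows "orth_projector {v. Swap *v v = c *s v} =
    (cscale (1/2) (mat 1 + cscale c Swap) :: ('d::finite \<times> 'd) op)"
proof -
  define P :: "('d \<times> 'd) op" where "P = cscale (1/2) (mat 1 + cscale c Swap)"
  let ?S = "{v. Swap *v v = c *s v}"
  have Pv: "(P *v v) $ i = (v $ i + c * v $ prod.swap i) / 2" for v i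
    by (simp add: P_def cscale_mult_vec matrix_vector_mult_add_rdistrib Swap_mult_vec)
  have cc: "c * (c * x) = x" for x
    using c by auto
  have "(P *v (P *v v)) $ i = (P *v v) $ i" for v i
    by (simp add: Pv add_divide_distrib distrib_left cc)
  then have "(P ** P) *v v = P *v v" for v
    by (simp only: vec_eq_iff simp_thms flip: matrix_vector_mul_assoc)
  then have idem: "P ** P = P"
    by (simp only: matrix_eq) simp
  have cnj_c: "cnj c = c"
    using c by auto
  have swap_iff: "i = prod.swap j \<longleftrightarrow> j = prod.swap i" for i j :: "'d \<times> 'd"
    by (metis swap_swap)
  have entry: "P $ i $ j = ((if i = j then 1 else 0) + c * (if j = prod.swap i then 1 else 0)) / 2"
    for i j
    by (simp add: P_def cscale_def mat_def Swap_def)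
  have "cnj (P $ j $ i) = P $ i $ j" for i j
    unfolding entry swap_iff[of i j] by (simp add: cnj_c)
  then have adj: "cadjoint P = P"
    by (simp add: cadjoint_def vec_eq_iff)
  have "(Swap *v (P *v v)) $ i = (c *s (P *v v)) $ i" for v i
    by (simp add: Pv Swap_mult_vec add_divide_distrib distrib_left cc)
  then have "P *v v \<in> ?S" for v
    by (simp only: vec_eq_iff mem_Collect_eq simp_thms)
  moreover have "v \<in> range ((*v) P)" if "v \<in> ?S" for v
  proof -
    have sw: "v $ prod.swap i = c * v $ i" for i
    proof -
      have "Swap *v v = c *s v"
        using that by (simp only: mem_Collect_eq)
      then show ?thesis
        by (metis Swap_mult_vec vector_smult_component)
    qed
    have "(P *v v) $ i = v $ i" for i
      unfolding Pv sw cc by simp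
    then have "v = P *v v"
      by (simp only: vec_eq_iff simp_thms)
    then show ?thesis
      by (rule range_eqI)
  qed
  ultimately have ran: "range ((*v) P) = ?S"
    by (intro equalityI image_subsetI subsetI)
  show ?thesis
    using orth_projector_eqI[OF idem adj ran] by (simp only: P_def)
qed

lemma Pi_plus_eq: "Pi_plus = cscale (1/2) (mat 1 + Swap)"
  using half_Swap_projector[of 1] by (simp add: Pi_plus_def sym_subspace_def)

lemma Pi_minus_eq: "Pi_minus = cscale (1/2) (mat 1 - Swap)"
proof -
  have "cscale (-1) A = - A" for A :: "('a \<times> 'a) op"
    by (simp add: cscale_def vec_eq_iff)
  then show ?thesis
    using half_Swap_projector[of "-1"] by (simp add: Pi_minus_def antisym_subspace_def)
qed

section \<open>Algebras and symmetry groups\<close>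

definition von_neumann_algebra :: "('d::finite) op set \<Rightarrow> bool" where
  "von_neumann_algebra \<A> \<longleftrightarrow>
     cmat.subspace \<A> \<and> mat 1 \<in> \<A> \<and>
     (\<forall>X\<in>\<A>. \<forall>Y\<in>\<A>. X ** Y \<in> \<A>) \<and> (\<forall>X\<in>\<A>. cadjoint X \<in> \<A>)"

definition gauge_group :: "('d::finite) op set \<Rightarrow> 'd op set" where
  "gauge_group \<A> = {V. unitary V \<and> (\<forall>X\<in>\<A>. V ** X = X ** V)}"

definition tensor_square :: "('d::finite) op set \<Rightarrow> ('d \<times> 'd) op set" where
  "tensor_square \<A> = cmat.span {tensor_op X Y |X Y. X \<in> \<A> \<and> Y \<in> \<A>}"

definition collective :: "('d::finite) op set \<Rightarrow> ('d \<times> 'd) op set" where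
  "collective G = {tensor_op V V |V. V \<in> G}"

definition permutation_group :: "('d::finite \<times> 'd) op set" where
  "permutation_group = {mat 1, Swap}"

section \<open>States and measurements\<close>

definition density_operators :: "('n::finite) op set" where
  "density_operators = {\<rho>. positive_op \<rho> \<and> trace \<rho> = 1}"

definition invariant_reference_measure :: "('n::finite) op measure \<Rightarrow> bool" where
  "invariant_reference_measure \<mu> \<longleftrightarrow>
     sets \<mu> = sets (restrict_space borel density_operators) \<and>
     (\<forall>V. unitary V \<longrightarrow> distr \<mu> \<mu> (conj_by V) = \<mu>)"

definition probability_density :: "('n::finite) op measure \<Rightarrow> ('n op \<Rightarrow> real) \<Rightarrow> bool" where
  "probability_density \<mu> p \<longleftrightarrow> (\<forall>\<rho>\<in>space \<mu>. 0 \<le> p \<rho>) \<and> has_bochner_integral \<mu> p 1"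

definition supp :: "(('n::finite) op \<Rightarrow> real) \<Rightarrow> 'n op set" where
  "supp p = {\<rho>\<in>density_operators. p \<rho> \<noteq> 0}"

definition prior_symmetry :: "('n::finite) op set \<Rightarrow> ('n op \<Rightarrow> real) \<Rightarrow> bool" where
  "prior_symmetry H p \<longleftrightarrow> (\<forall>V\<in>H. \<forall>\<rho>\<in>density_operators. p (conj_by V \<rho>) = p \<rho>)"

definition parameter_symmetry ::
  "('n::finite) op set \<Rightarrow> ('n op \<Rightarrow> real) \<Rightarrow> ('n op \<Rightarrow> real^'l) \<Rightarrow> bool" where
  "parameter_symmetry H p s \<longleftrightarrow> (\<forall>V\<in>H. \<forall>\<rho>\<in>supp p. s (conj_by V \<rho>) = s \<rho>)"

definition POVM :: "'w set \<Rightarrow> 'w set set \<Rightarrow> ('w set \<Rightarrow> ('n::finite) op) \<Rightarrow> bool" where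
  "POVM \<Omega> \<Sigma> M \<longleftrightarrow>
     (\<forall>B\<in>\<Sigma>. positive_op (M B)) \<and> M \<Omega> = mat 1 \<and>
     (\<forall>F :: nat \<Rightarrow> 'w set. range F \<subseteq> \<Sigma> \<longrightarrow> disjoint_family F \<longrightarrow>
        (\<lambda>k. M (F k)) sums M (\<Union>k. F k))"

definition outcome_prob :: "('w set \<Rightarrow> ('n::finite) op) \<Rightarrow> 'w set \<Rightarrow> 'n op \<Rightarrow> complex" where
  "outcome_prob M B \<rho> = trace (M B ** \<rho>)"

definition parameter_prob ::
  "('n::finite) op measure \<Rightarrow> ('n op \<Rightarrow> real) \<Rightarrow> ('n op \<Rightarrow> real^'l) \<Rightarrow> (real^'l) set \<Rightarrow> real" where
  "parameter_prob \<mu> p s \<Delta> = (LINT \<rho>:{\<rho>\<in>supp p. s \<rho> \<in> \<Delta>}|\<mu>. p \<rho>)"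

definition cond_outcome_prob ::
  "('n::finite) op measure \<Rightarrow> ('n op \<Rightarrow> real) \<Rightarrow> ('n op \<Rightarrow> real^'l) \<Rightarrow>
   ('w set \<Rightarrow> 'n op) \<Rightarrow> 'w set \<Rightarrow> (real^'l) set \<Rightarrow> complex" where
  "cond_outcome_prob \<mu> p s M B \<Delta> =
     1 / complex_of_real (parameter_prob \<mu> p s \<Delta>) *
     (LINT \<rho>:{\<rho>\<in>supp p. s \<rho> \<in> \<Delta>}|\<mu>. complex_of_real (p \<rho>) * outcome_prob M B \<rho>)"

end

theory Submission
  imports Defs
begin

text \<open>Let \<open>E\<close> be the Hilbert-Schmidt orthogonal projection onto the commutant of the symmetries
  \<open>V \<otimes> V\<close> and \<open>Swap\<close>. It preserves positivity and the identity, and since the average state over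
  a parameter region commutes with the symmetries, \<open>M' = E \<circ> M\<close> has the same statistics as \<open>M\<close>.
  By a generalization of Schur-Weyl duality, \<open>M' B = X + Swap Y\<close> with \<open>X\<close>, \<open>Y\<close> in the tensor
  square of \<open>\<A>\<close>, so that on the range of each projector \<open>Pi\<^sub>\<plusminus>\<close> it agrees with some \<open>T\<close> in the
  tensor square. Such a \<open>T\<close> need not be positive, but \<open>T P\<close> is, where \<open>P\<close> projects onto the
  subspace generated from the range of \<open>Pi\<^sub>\<plusminus>\<close> by the commutant of the tensor square; and \<open>T P\<close>
  depends linearly on \<open>M' B Pi\<^sub>\<plusminus>\<close>.\<close>

section \<open>Matrix algebra\<close>

text \<open>\<open>E\<close> is the twirl over the compact group generated by the symmetries, but
  described as an orthogonal projection it needs no Haar integral. On complex vectors and operators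
  \<open>\<bullet>\<close> is the real part of the Hermitian product; for complex subspaces real and
  complex orthogonality agree, so projecting in the real sense loses nothing. The representative
  \<open>T\<close> exists because \<open>Swap\<close> is a scalar \<open>c\<close>, namely
  \<open>1\<close> or \<open>-1\<close>, on the range of each projector, where
  \<open>X + Swap Y\<close> therefore acts as \<open>X + c Y\<close>. Off that range
  \<open>T\<close> is in general not determined by \<open>M' B\<close>: it may be negative there,
  and choices made separately for each \<open>B\<close> need not add up. Cutting down to
  \<open>P\<close> removes this freedom, since an element of the tensor square that vanishes on the
  range of the projector vanishes on everything the commutant generates from it. The lifted operator
  is then the value of one linear map, and in finite dimension linearity carries over countable
  additivity.\<close>

lemma mm_add_left: "(A + B) ** C = A ** C + B ** (C :: complex^'n^'m)"
  by (simp add: matrix_matrix_mult_def vec_eq_iff distrib_right sum.distrib)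

lemma mm_diff_left: "(A - B) ** C = A ** C - B ** (C :: complex^'n^'m)"
  by (simp add: matrix_matrix_mult_def vec_eq_iff left_diff_distrib sum_subtractf)

lemma mm_diff_right: "A ** (B - C) = A ** B - A ** (C :: complex^'n^'m)"
  by (simp add: matrix_matrix_mult_def vec_eq_iff right_diff_distrib sum_subtractf)

lemma mm_minus_left: "(- A) ** C = - (A ** (C :: complex^'n^'m))"
  by (simp add: matrix_matrix_mult_def vec_eq_iff sum_negf)

lemma mm_minus_right: "A ** (- C) = - (A ** (C :: complex^'n^'m))"
  by (simp add: matrix_matrix_mult_def vec_eq_iff sum_negf)

lemma mm_cscale_left: "cscale c A ** B = cscale c (A ** B)"
  by (simp add: matrix_matrix_mult_def vec_eq_iff cscale_def sum_distrib_left mult_ac)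

lemma mm_cscale_right: "A ** cscale c B = cscale c (A ** B)"
  by (simp add: matrix_matrix_mult_def vec_eq_iff cscale_def sum_distrib_left mult_ac)

lemma mm_zero_left: "0 ** A = (0 :: complex^'n^'m)"
  by (simp add: matrix_matrix_mult_def vec_eq_iff)

lemma mm_zero_right: "A ** 0 = (0 :: complex^'n^'m)"
  by (simp add: matrix_matrix_mult_def vec_eq_iff)

lemmas mm_simps = mm_add_left matrix_add_ldistrib mm_diff_left mm_diff_right mm_minus_left
  mm_minus_right mm_cscale_left mm_cscale_right mm_zero_left mm_zero_right

lemma linear_mm_left: "linear (\<lambda>X. A ** (X :: complex^'n^'m))"
  by (rule linearI) (simp_all add: matrix_matrix_mult_def vec_eq_iff distrib_left sum.distrib
      scaleR_sum_right)

lemma linear_mm_right: "linear (\<lambda>X :: complex^'n^'m. X ** A)"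
  by (rule linearI) (simp_all add: matrix_matrix_mult_def vec_eq_iff distrib_right sum.distrib
      scaleR_sum_right)

lemma scaleR_eq_cscale: "r *\<^sub>R A = cscale (of_real r) A"
  by (simp add: cscale_def vec_eq_iff scaleR_conv_of_real[where 'a = complex])

lemma scaleR_mult_vec: "(r *\<^sub>R A) *v x = r *\<^sub>R (A *v x)" for A :: "complex^'n^'m"
  by (simp add: matrix_vector_mult_def vec_eq_iff scaleR_sum_right)

lemma linear_cscale: "linear (cscale c :: complex^'n^'m \<Rightarrow> _)"
  by (rule linearI) (simp_all add: cscale_def vec_eq_iff distrib_left)

lemma linear_vector_scalar_mult: "linear ((*s) c :: complex^'n \<Rightarrow> _)"
  by (rule linearI) (simp_all add: vec_eq_iff distrib_left)

lemma cadjoint_cadjoint [simp]: "cadjoint (cadjoint A) = A"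
  by (simp add: cadjoint_def vec_eq_iff)

lemma cadjoint_mult: "cadjoint (A ** B) = cadjoint B ** cadjoint A"
  by (simp add: cadjoint_def matrix_matrix_mult_def vec_eq_iff mult.commute)

lemma cadjoint_add: "cadjoint (A + B) = cadjoint A + cadjoint B"
  by (simp add: cadjoint_def vec_eq_iff)

lemma cadjoint_diff: "cadjoint (A - B) = cadjoint A - cadjoint B"
  by (simp add: cadjoint_def vec_eq_iff)

lemma cadjoint_cscale: "cadjoint (cscale c A) = cscale (cnj c) (cadjoint A)"
  by (simp add: cadjoint_def cscale_def vec_eq_iff)

lemma cadjoint_mat_1 [simp]: "cadjoint (mat 1) = mat 1"
  by (simp add: cadjoint_def mat_def vec_eq_iff)

lemma cadjoint_zero [simp]: "cadjoint 0 = 0"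
  by (simp add: cadjoint_def vec_eq_iff)

lemmas cadjoint_simps = cadjoint_mult cadjoint_add cadjoint_diff cadjoint_cscale

lemma cscale_half_double: "cscale (1/2) (A + A) = A"
  by (simp add: cscale_def vec_eq_iff)

section \<open>Real inner products and adjoints\<close>

lemma inner_mult_vec: "(A *v x) \<bullet> y = x \<bullet> (cadjoint A *v (y :: complex^'n))"
proof -
  have "(A *v x) \<bullet> y = (\<Sum>i\<in>UNIV. \<Sum>j\<in>UNIV. Re (cnj (A $ i $ j * x $ j) * y $ i))"
    by (simp add: inner_vec_def matrix_vector_mult_def inner_complex_def sum_distrib_right
        sum_distrib_left algebra_simps flip: sum.distrib)
  also have "\<dots> = (\<Sum>j\<in>UNIV. \<Sum>i\<in>UNIV. Re (cnj (A $ i $ j * x $ j) * y $ i))"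
    by (rule sum.swap)
  also have "\<dots> = x \<bullet> (cadjoint A *v y)"
    by (simp add: inner_vec_def matrix_vector_mult_def inner_complex_def cadjoint_def
        sum_distrib_left algebra_simps flip: sum.distrib)
  finally show ?thesis .
qed

text \<open>Left multiplication acts on each column separately, so this carries
  \<open>inner_mult_vec\<close> over to operators.\<close>

lemma inner_op_columns: "(A :: complex^'n^'m) \<bullet> B = (\<Sum>j\<in>UNIV. column j A \<bullet> column j B)"
  unfolding inner_vec_def column_def by simp (rule sum.swap)

lemma column_mm: "column j (A ** B) = A *v column j (B :: complex^'n^'m)"
  by (simp add: column_def matrix_matrix_mult_def matrix_vector_mult_def)

lemma inner_mm_left: "(A ** X) \<bullet> Y = X \<bullet> (cadjoint A ** (Y :: complex^'n^'m))"
  by (simp add: inner_op_columns column_mm inner_mult_vec)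

lemma inner_cadjoint: "cadjoint A \<bullet> cadjoint B = A \<bullet> (B :: complex^'n^'m)"
  unfolding inner_vec_def cadjoint_def by (simp add: inner_complex_def) (rule sum.swap)

lemma inner_mm_right: "(X ** A) \<bullet> Y = X \<bullet> (Y ** cadjoint (A :: complex^'n^'m))"
  using inner_mm_left[of "cadjoint A" "cadjoint X" "cadjoint Y"]
    inner_cadjoint[of "X ** A" Y] inner_cadjoint[of X "Y ** cadjoint A"]
  by (simp add: cadjoint_mult)

lemma Re_trace_mult: "Re (trace (A ** B)) = cadjoint A \<bullet> B"
proof -
  have "Re (trace (A ** B)) = (\<Sum>i\<in>UNIV. \<Sum>j\<in>UNIV. cnj (A $ i $ j) \<bullet> B $ j $ i)"
    by (simp add: trace_def matrix_matrix_mult_def inner_complex_def)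
  also have "\<dots> = cadjoint A \<bullet> B"
    unfolding inner_vec_def cadjoint_def by simp (rule sum.swap)
  finally show ?thesis .
qed

lemma inner_vector_scalar_mult: "(c *s x) \<bullet> y = x \<bullet> (cnj c *s (y :: complex^'n))"
  by (simp add: inner_vec_def inner_complex_def algebra_simps)

lemma inner_cscale: "cscale c X \<bullet> Y = X \<bullet> cscale (cnj c) Y"
  by (simp add: inner_vec_def cscale_def inner_complex_def algebra_simps)

lemma Re_cinner: "Re (cinner x y) = x \<bullet> y"
  by (simp add: cinner_def inner_vec_def inner_complex_def)

lemma cinner_mult_vec: "cinner (A *v x) y = cinner x (cadjoint A *v y)"
proof (rule complex_eqI)
  show "Re (cinner (A *v x) y) = Re (cinner x (cadjoint A *v y))"
    by (simp add: Re_cinner inner_mult_vec)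
  \<comment> \<open>Multiplication by \<open>\<i>\<close> turns imaginary parts into real parts, so
    the real identity suffices.\<close>
  have Im: "Im (cinner u v) = - (u \<bullet> (\<i> *s v))" for u v :: "complex^'m"
    by (simp add: cinner_def inner_vec_def inner_complex_def sum_negf[symmetric])
  have Im2: "Im (cinner u v) = - (u \<bullet> (\<i> *s v))" for u v :: "complex^'n"
    by (simp add: cinner_def inner_vec_def inner_complex_def sum_negf[symmetric])
  show "Im (cinner (A *v x) y) = Im (cinner x (cadjoint A *v y))"
    unfolding Im Im2 by (simp add: inner_mult_vec vector_scalar_commute)
qed

section \<open>Positive operators\<close>

lemma positive_op_inner_nonneg: "positive_op A \<Longrightarrow> 0 \<le> x \<bullet> (A *v x)"
  by (simp add: positive_op_def complex_nonneg_Reals_iff flip: Re_cinner)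

lemma cinner_add_left: "cinner (x + y) z = cinner x z + cinner y z"
  by (simp add: cinner_def distrib_right sum.distrib)

lemma cinner_add_right: "cinner x (y + z) = cinner x y + cinner x z"
  by (simp add: cinner_def distrib_left sum.distrib)

lemma cinner_scale_left: "cinner (c *s x) y = cnj c * cinner x y"
  by (simp add: cinner_def sum_distrib_left mult_ac)

lemma cinner_scale_right: "cinner x (c *s y) = c * cinner x y"
  by (simp add: cinner_def sum_distrib_left mult_ac)

lemma cnj_cinner: "cnj (cinner x y) = cinner y x"
  by (simp add: cinner_def mult.commute)

lemma cinner_axis: "cinner (axis i 1) y = y $ i"
  by (simp add: cinner_def axis_def if_distrib if_distribR cong: if_cong)

lemma mult_vec_axis: "(A *v axis j 1) $ i = A $ i $ (j :: 'n::finite)" for A :: "complex^'n^'m"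
  by (simp add: matrix_vector_mult_def axis_def if_distrib if_distribR cong: if_cong)

text \<open>Polarization: the quadratic form is real at \<open>x + c *s y\<close> for
  \<open>c = 1\<close> and \<open>c = \<i>\<close>, which makes the sesquilinear form Hermitian;
  basis vectors then give the entries.\<close>

lemma positive_op_hermitian:
  assumes "positive_op A"
  shows "cadjoint A = A"
proof -
  have real: "Im (cinner v (A *v v)) = 0" for v
    using assms by (simp add: positive_op_def complex_nonneg_Reals_iff)
  have pol: "cinner (x + c *s y) (A *v (x + c *s y)) = cinner x (A *v x) + cnj c * c * cinner y (A *v y)
     + (c * cinner x (A *v y) + cnj c * cinner y (A *v x))" for x y c
    by (simp add: matrix_vector_right_distrib vector_scalar_commute cinner_add_left
        cinner_add_right cinner_scale_left cinner_scale_right algebra_simps)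
  have herm: "Im (c * cinner x (A *v y) + cnj c * cinner y (A *v x)) = 0" for x y c
    using arg_cong[OF pol[of x c y], of Im] real[of "x + c *s y"] real[of x] real[of y]
    by (simp add: algebra_simps)
  have sa: "cinner x (A *v y) = cnj (cinner y (A *v x))" for x y
    using herm[of 1 x y] herm[of \<i> x y] by (intro complex_eqI) (simp_all add: algebra_simps)
  have "cnj (A $ j $ i) = A $ i $ j" for i j
    using sa[of "axis i 1" "axis j 1", symmetric] unfolding cinner_axis mult_vec_axis .
  then show ?thesis
    by (simp add: cadjoint_def vec_eq_iff)
qed

lemma positive_op_iff:
  "positive_op A \<longleftrightarrow> cadjoint A = A \<and> (\<forall>x. 0 \<le> x \<bullet> (A *v x))"
proof (intro iffI conjI)
  assume A: "cadjoint A = A \<and> (\<forall>x. 0 \<le> x \<bullet> (A *v x))"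
  have "Im (cinner x (A *v x)) = 0" for x
  proof -
    have "cnj (cinner x (A *v x)) = cinner x (A *v x)"
      using A by (metis cinner_mult_vec cnj_cinner)
    then show ?thesis
      by (simp add: complex_eq_iff)
  qed
  then show "positive_op A"
    using A unfolding positive_op_def by (simp add: complex_nonneg_Reals_iff Re_cinner)
qed (auto simp: positive_op_hermitian positive_op_inner_nonneg)

section \<open>Orthogonal projections and commutants\<close>

text \<open>Defined on any Euclidean space, so that it serves both for vectors and for
  operators.\<close>

definition orth_proj :: "'a::euclidean_space set \<Rightarrow> 'a \<Rightarrow> 'a" where
  "orth_proj W x = (THE y. y \<in> W \<and> (\<forall>w\<in>W. (x - y) \<bullet> w = 0))"

lemma orth_proj_eqI:
  assumes W: "subspace W" and y: "y \<in> W" "\<And>w. w \<in> W \<Longrightarrow> (x - y) \<bullet> w = 0"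
  shows "orth_proj W x = y"
  unfolding orth_proj_def
proof (rule the_equality)
  fix z assume z: "z \<in> W \<and> (\<forall>w\<in>W. (x - z) \<bullet> w = 0)"
  have "z - y \<in> W"
    using W z y by (simp add: subspace_diff)
  then have "(x - y) \<bullet> (z - y) = 0" "(x - z) \<bullet> (z - y) = 0"
    using z y by auto
  then have "(z - y) \<bullet> (z - y) = 0"
    by (simp add: inner_diff_left)
  then show "z = y"
    by simp
qed (use y in simp)

lemma
  assumes "subspace W"
  shows orth_proj_in: "orth_proj W x \<in> W"
    and orth_proj_orth: "w \<in> W \<Longrightarrow> (x - orth_proj W x) \<bullet> w = 0"
proof -
  obtain y z where yz: "y \<in> span W" "\<And>w. w \<in> span W \<Longrightarrow> orthogonal z w" "x = y + z"
    using orthogonal_subspace_decomp_exists[of W x] by blast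
  moreover have "span W = W"
    using assms by (simp only: span_eq_iff)
  ultimately have yz: "y \<in> W" "\<And>w. w \<in> W \<Longrightarrow> z \<bullet> w = 0" "x = y + z"
    by (auto simp: orthogonal_def)
  then have "orth_proj W x = y"
    using assms by (intro orth_proj_eqI) auto
  then show "orth_proj W x \<in> W" "w \<in> W \<Longrightarrow> (x - orth_proj W x) \<bullet> w = 0"
    using yz by auto
qed

lemma orth_proj_id: "subspace W \<Longrightarrow> x \<in> W \<Longrightarrow> orth_proj W x = x"
  by (rule orth_proj_eqI) simp_all

text \<open>Invariance of \<open>W\<close> under the adjoint \<open>g\<close> makes the orthogonal
  complement invariant under \<open>f\<close>, so \<open>f\<close> respects both summands. Different
  choices of \<open>f\<close> yield complex homogeneity, compatibility with adjoints and
  compatibility with multiplication.\<close>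

lemma orth_proj_commute:
  assumes W: "subspace W" and f: "linear f" and fg: "\<And>x y. f x \<bullet> y = x \<bullet> g y"
    and inv: "\<And>w. w \<in> W \<Longrightarrow> f w \<in> W" "\<And>w. w \<in> W \<Longrightarrow> g w \<in> W"
  shows "orth_proj W (f x) = f (orth_proj W x)"
proof (rule orth_proj_eqI[OF W])
  show "f (orth_proj W x) \<in> W"
    using inv orth_proj_in[OF W] by blast
  fix w assume "w \<in> W"
  then show "(f x - f (orth_proj W x)) \<bullet> w = 0"
    using orth_proj_orth[OF W, of "g w" x] inv by (simp add: fg flip: linear_diff[OF f])
qed

lemma linear_orth_proj:
  assumes W: "subspace W"
  shows "linear (orth_proj W)"
proof (rule linearI)
  show "orth_proj W (x + y) = orth_proj W x + orth_proj W y" for x y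
    using orth_proj_in[OF W] orth_proj_orth[OF W, of _ x] orth_proj_orth[OF W, of _ y] W
    by (intro orth_proj_eqI) (auto simp: subspace_add inner_diff_left inner_add_left)
  show "orth_proj W (r *\<^sub>R x) = r *\<^sub>R orth_proj W x" for r x
    by (rule orth_proj_commute[where g = "(*\<^sub>R) r"]) (auto simp: W subspace_scale)
qed

lemma orth_proj_self_adjoint:
  assumes W: "subspace W"
  shows "orth_proj W x \<bullet> y = x \<bullet> orth_proj W y"
  using orth_proj_orth[OF W orth_proj_in[OF W, of y], of x]
    orth_proj_orth[OF W orth_proj_in[OF W, of x], of y]
    inner_commute[of y "orth_proj W x"] inner_commute[of "orth_proj W y" "orth_proj W x"]
  by (simp add: inner_diff_left)

lemma subspace_of_vec_subspace: "vec.subspace W \<Longrightarrow> subspace (W :: (complex^'n) set)"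
  unfolding subspace_def vec.subspace_def
  by (metis scaleR_conv_of_real vec_eq_iff vector_scaleR_component vector_smult_component)

lemma subspace_of_cmat_subspace: "cmat.subspace W \<Longrightarrow> subspace W"
  unfolding subspace_def cmat.subspace_def by (simp add: scaleR_eq_cscale)

lemma orth_proj_cscale:
  fixes W :: "(complex^'n::finite^'m::finite) set"
  assumes "cmat.subspace W"
  shows "orth_proj W (cscale c X) = cscale c (orth_proj W X)"
  using assms
  by (intro orth_proj_commute[where g = "cscale (cnj c)"])
    (auto simp: subspace_of_cmat_subspace linear_cscale inner_cscale cmat.subspace_scale)

definition proj_op :: "(complex^'n) set \<Rightarrow> ('n::finite) op" where
  "proj_op W = matrix (orth_proj W)"

lemma op_eq_by_inner:
  fixes A B :: "complex^'n^'m"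
  assumes "\<And>x y. y \<bullet> (A *v x) = y \<bullet> (B *v x)"
  shows "A = B"
proof -
  have "A *v x = B *v x" for x
    using assms[of _ x] by (metis vector_eq_ldot)
  then show ?thesis
    by (simp add: matrix_eq)
qed

context
  fixes W :: "(complex^'n::finite) set"
  assumes W: "vec.subspace W"
begin

text \<open>\<open>matrix\<close> represents complex linear maps, whereas
  \<open>linear_orth_proj\<close> is real linearity. The gap is closed by commuting with
  multiplication by \<open>c\<close>, whose adjoint is multiplication by
  \<open>cnj c\<close>.\<close>

lemma proj_op_mult_vec: "proj_op W *v x = orth_proj W x"
  unfolding proj_op_def
proof (rule matrix_works)
  have sW: "subspace W"
    by (rule subspace_of_vec_subspace[OF W])
  have "orth_proj W (c *s x) = c *s orth_proj W x" for c x
    using W by (intro orth_proj_commute[where g = "(*s) (cnj c)"])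
      (auto simp: sW linear_vector_scalar_mult inner_vector_scalar_mult vec.subspace_scale)
  then show "Vector_Spaces.linear (*s) (*s) (orth_proj W)"
    using linear_add[OF linear_orth_proj[OF sW]]
    by (intro Vector_Spaces.linear_iff[THEN iffD2] conjI vec.vector_space_axioms) auto
qed

lemma proj_op_in: "proj_op W *v x \<in> W"
  by (simp add: proj_op_mult_vec orth_proj_in subspace_of_vec_subspace W)

lemma proj_op_id: "x \<in> W \<Longrightarrow> proj_op W *v x = x"
  by (simp add: proj_op_mult_vec orth_proj_id subspace_of_vec_subspace W)

lemma proj_op_mult_id:
  assumes "\<And>x. A *v x \<in> W"
  shows "proj_op W ** A = A"
proof -
  have "(proj_op W ** A) *v x = A *v x" for x
    using assms by (simp add: proj_op_id flip: matrix_vector_mul_assoc)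
  then show ?thesis
    by (simp only: matrix_eq) simp
qed

lemma proj_op_idem: "proj_op W ** proj_op W = proj_op W"
  by (rule proj_op_mult_id[OF proj_op_in])

lemma cadjoint_proj_op: "cadjoint (proj_op W) = proj_op W"
  by (rule op_eq_by_inner)
    (simp add: proj_op_mult_vec orth_proj_self_adjoint subspace_of_vec_subspace W
      flip: inner_mult_vec)

lemma proj_op_commute:
  assumes "\<And>w. w \<in> W \<Longrightarrow> A *v w \<in> W" "\<And>w. w \<in> W \<Longrightarrow> cadjoint A *v w \<in> W"
  shows "proj_op W ** A = A ** proj_op W"
proof -
  have "orth_proj W (A *v x) = A *v orth_proj W x" for x
    using assms by (intro orth_proj_commute[where g = "(*v) (cadjoint A)"])
      (auto simp: subspace_of_vec_subspace W inner_mult_vec)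
  then have "(proj_op W ** A) *v x = (A ** proj_op W) *v x" for x
    by (simp add: proj_op_mult_vec flip: matrix_vector_mul_assoc)
  then show ?thesis
    by (simp only: matrix_eq) simp
qed

end

text \<open>The minimum of the Rayleigh quotient over the unit sphere of \<open>W\<close> is attained at an
  eigenvector.\<close>

lemma negative_eigenvector:
  fixes T :: "'a::euclidean_space \<Rightarrow> 'a"
  assumes T: "linear T" and sa: "\<And>x y. T x \<bullet> y = x \<bullet> T y"
    and W: "subspace W" and inv: "\<And>w. w \<in> W \<Longrightarrow> T w \<in> W"
    and w: "w \<in> W" "w \<bullet> T w < 0"
  obtains f l where "f \<in> W" "f \<noteq> 0" "l < 0" "T f = l *\<^sub>R f"
proof -
  define K where "K = sphere 0 1 \<inter> W"
  have w0: "w \<noteq> 0"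
    using w by auto
  have "compact K"
    unfolding K_def using W by (intro compact_Int_closed compact_sphere closed_subspace)
  moreover have wK: "w /\<^sub>R norm w \<in> K"
    using w w0 W by (simp add: K_def subspace_scale)
  moreover have "continuous_on K (\<lambda>x. x \<bullet> T x)"
    by (intro continuous_intros linear_continuous_on linear_conv_bounded_linear[THEN iffD1] T)
  ultimately obtain f where f: "f \<in> K" and fmin: "\<And>x. x \<in> K \<Longrightarrow> f \<bullet> T f \<le> x \<bullet> T x"
    using continuous_attains_inf[of K "\<lambda>x. x \<bullet> T x"] by blast
  define l where "l = f \<bullet> T f"
  have fW: "f \<in> W" and ff: "f \<bullet> f = 1"
    using f by (auto simp: K_def dot_square_norm)
  have "l \<le> (w /\<^sub>R norm w) \<bullet> T (w /\<^sub>R norm w)"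
    using fmin[OF wK] by (simp add: l_def)
  also have "\<dots> = (w \<bullet> T w) * (inverse (norm w))\<^sup>2"
    by (simp add: linear_scale[OF T] power2_eq_square)
  also have "\<dots> < 0"
    using w w0 by (intro mult_neg_pos) auto
  finally have l: "l < 0" .
  have ge: "0 \<le> x \<bullet> (T x - l *\<^sub>R x)" if x: "x \<in> W" for x
  proof (cases "x = 0")
    case False
    have "x /\<^sub>R norm x \<in> K"
      using x False W by (simp add: K_def subspace_scale)
    from fmin[OF this] have "l \<le> (x \<bullet> T x) / (norm x)\<^sup>2"
      by (simp add: l_def linear_scale[OF T] power2_eq_square field_simps)
    then have "l * (x \<bullet> x) \<le> x \<bullet> T x"
      using False by (simp add: field_simps power2_norm_eq_inner)
    then show ?thesis
      by (simp add: inner_diff_right)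
  qed simp
  \<comment> \<open>The residual of \<open>f\<close> as an eigenvector. If it were nonzero, moving
    from \<open>f\<close> in the direction \<open>- g\<close> would make the nonnegative form of
    \<open>T - l\<close> negative.\<close>
  define g where "g = T f - l *\<^sub>R f"
  have Tf: "T f = g + l *\<^sub>R f"
    by (simp add: g_def)
  have gW: "g \<in> W"
    unfolding g_def using fW inv W by (simp add: subspace_diff subspace_scale)
  have fg: "f \<bullet> g = 0"
    by (simp add: g_def inner_diff_right ff) (simp add: l_def)
  have quad: "0 \<le> 2 * t * (g \<bullet> g) + t\<^sup>2 * (g \<bullet> (T g - l *\<^sub>R g))" for t
  proof -
    have "f + t *\<^sub>R g \<in> W"
      using fW gW W by (simp add: subspace_add subspace_scale)
    from ge[OF this] have "0 \<le> (f + t *\<^sub>R g) \<bullet> (g + t *\<^sub>R (T g - l *\<^sub>R g))"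
      by (simp add: Tf linear_add[OF T] linear_scale[OF T] algebra_simps)
    also have "\<dots> = f \<bullet> g + t * (g \<bullet> g) + t * (f \<bullet> (T g - l *\<^sub>R g)) + t\<^sup>2 * (g \<bullet> (T g - l *\<^sub>R g))"
      by (simp add: inner_add_left inner_add_right power2_eq_square algebra_simps)
    also have "f \<bullet> (T g - l *\<^sub>R g) = g \<bullet> g"
      by (simp add: inner_diff_right Tf inner_add_left fg flip: sa)
    finally show ?thesis
      by (simp add: fg)
  qed
  have "g \<bullet> g = 0"
  proof (rule ccontr)
    define a where "a = g \<bullet> g"
    define b where "b = g \<bullet> (T g - l *\<^sub>R g)"
    assume "g \<bullet> g \<noteq> 0"
    then have a: "a > 0"
      by (simp add: a_def)
    have b: "b \<ge> 0"
      unfolding b_def by (rule ge[OF gW])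
    \<comment> \<open>A negative \<open>t\<close> small enough for the linear term to win;
      \<open>b + 1\<close> in place of \<open>b\<close> allows for \<open>b = 0\<close>.\<close>
    have "0 \<le> 2 * (- (a / (b + 1))) * a + (- (a / (b + 1)))\<^sup>2 * b"
      using quad unfolding a_def b_def by blast
    also have "\<dots> = - (a\<^sup>2 * (b + 2) / (b + 1)\<^sup>2)"
      using b by (simp add: divide_simps power2_eq_square) (simp add: algebra_simps)
    also have "\<dots> < 0"
      using a b by simp
    finally show False
      by simp
  qed
  then have "T f = l *\<^sub>R f"
    by (simp add: g_def)
  moreover have "f \<noteq> 0"
    using ff by auto
  ultimately show ?thesis
    using that fW l by blast
qed

section \<open>Commutants of sets closed under adjoints\<close>

lemma commutes_mult:
  fixes X :: "('n::finite) op"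
  assumes "X ** Y = Y ** X" "X ** Z = Z ** X"
  shows "X ** (Y ** Z) = Y ** Z ** X"
proof -
  have "X ** (Y ** Z) = Y ** (X ** Z)"
    using assms(1) by (simp add: matrix_mul_assoc)
  then show ?thesis
    using assms(2) by (simp add: matrix_mul_assoc)
qed

definition commutant :: "('n::finite) op set \<Rightarrow> 'n op set" where
  "commutant H = {X. \<forall>Y\<in>H. X ** Y = Y ** X}"

lemma commutantI: "(\<And>Y. Y \<in> H \<Longrightarrow> X ** Y = Y ** X) \<Longrightarrow> X \<in> commutant H"
  by (simp add: commutant_def)

lemma commutantD: "X \<in> commutant H \<Longrightarrow> Y \<in> H \<Longrightarrow> X ** Y = Y ** X"
  by (simp add: commutant_def)

lemma von_neumann_algebra_commutant:
  assumes H: "\<And>X. X \<in> H \<Longrightarrow> cadjoint X \<in> H"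
  shows "von_neumann_algebra (commutant H)"
  unfolding von_neumann_algebra_def
proof (intro conjI ballI)
  show "cmat.subspace (commutant H)"
    by (auto simp: cmat.subspace_def commutant_def mm_simps)
  show "mat 1 \<in> commutant H"
    by (simp add: commutant_def)
  show "X ** Y \<in> commutant H" if "X \<in> commutant H" "Y \<in> commutant H" for X Y
    using that commutes_mult[of _ X Y] by (simp add: commutant_def)
  show "cadjoint X \<in> commutant H" if X: "X \<in> commutant H" for X
  proof (rule commutantI)
    fix Y assume "Y \<in> H"
    then have "X ** cadjoint Y = cadjoint Y ** X"
      using X H by (simp add: commutant_def)
    from arg_cong[OF this, of cadjoint] show "cadjoint X ** Y = Y ** cadjoint X"
      by (simp add: cadjoint_mult)
  qed
qed

lemma
  assumes "von_neumann_algebra \<A>"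
  shows vN_subspace: "cmat.subspace \<A>"
    and vN_1: "mat 1 \<in> \<A>"
    and vN_mult: "X \<in> \<A> \<Longrightarrow> Y \<in> \<A> \<Longrightarrow> X ** Y \<in> \<A>"
    and vN_adjoint: "X \<in> \<A> \<Longrightarrow> cadjoint X \<in> \<A>"
    and vN_add: "X \<in> \<A> \<Longrightarrow> Y \<in> \<A> \<Longrightarrow> X + Y \<in> \<A>"
    and vN_diff: "X \<in> \<A> \<Longrightarrow> Y \<in> \<A> \<Longrightarrow> X - Y \<in> \<A>"
    and vN_cscale: "X \<in> \<A> \<Longrightarrow> cscale c X \<in> \<A>"
  using assms cmat.subspace_add cmat.subspace_diff cmat.subspace_scale
  unfolding von_neumann_algebra_def by blast+

text \<open>If the projection had a negative eigenvalue, the corresponding spectral projector \<open>P\<close>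
  would lie in the commutant, so that the projection and \<open>X\<close> have the same inner product
  with \<open>P\<close>; but the first one is negative and the second one is not.\<close>

lemma positive_op_orth_proj_commutant:
  assumes H: "\<And>Y. Y \<in> H \<Longrightarrow> cadjoint Y \<in> H" and X: "positive_op X"
  shows "positive_op (orth_proj (commutant H) X)"
proof -
  let ?B = "commutant H"
  define Z where "Z = orth_proj ?B X"
  have vN: "von_neumann_algebra ?B"
    by (rule von_neumann_algebra_commutant[OF H])
  then have B: "subspace ?B"
    by (intro subspace_of_cmat_subspace vN_subspace)
  have ZB: "Z \<in> ?B"
    unfolding Z_def by (rule orth_proj_in[OF B])
  have "linear (cadjoint :: 'a op \<Rightarrow> _)"
    by (rule linearI) (simp_all add: cadjoint_add scaleR_eq_cscale cadjoint_cscale)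
  moreover have "cadjoint A \<bullet> A' = A \<bullet> cadjoint A'" for A A' :: "'a op"
    using inner_cadjoint[of A "cadjoint A'"] by simp
  ultimately have "cadjoint Z = orth_proj ?B (cadjoint X)"
    unfolding Z_def using vN_adjoint[OF vN]
    by (intro orth_proj_commute[where g = cadjoint, symmetric] B)
  then have Zh: "cadjoint Z = Z"
    using X by (simp add: positive_op_hermitian Z_def)
  have "0 \<le> x \<bullet> (Z *v x)" for x
  proof (rule ccontr)
    assume "\<not> 0 \<le> x \<bullet> (Z *v x)"
    then obtain f l where f: "f \<noteq> 0" "l < 0" "Z *v f = l *\<^sub>R f"
      using negative_eigenvector[of "(*v) Z" UNIV x] by (auto simp: inner_mult_vec Zh)
    \<comment> \<open>The whole eigenspace rather than the line through \<open>f\<close>: it is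
      invariant under \<open>H\<close>, which puts its projector in the commutant.\<close>
    define W where "W = {v. Z *v v = complex_of_real l *s v}"
    have smult: "complex_of_real r *s v = r *\<^sub>R v" for r and v :: "complex^'a"
      by (simp add: vec_eq_iff scaleR_conv_of_real[where 'a = complex])
    have W: "vec.subspace W"
      unfolding vec.subspace_def W_def
      by (simp add: matrix_vector_right_distrib vector_scalar_commute vector_add_ldistrib mult.commute)
    define P where "P = proj_op W"
    have fW: "f \<in> W"
      using f by (simp add: W_def smult)
    have inv: "Y *v v \<in> W" if "Y \<in> H" "v \<in> W" for Y v
    proof -
      have "Z *v (Y *v v) = Y *v (Z *v v)"
        using commutantD[OF ZB \<open>Y \<in> H\<close>] by (simp add: matrix_vector_mul_assoc)
      then show ?thesis
        using \<open>v \<in> W\<close> by (simp add: W_def vector_scalar_commute)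
    qed
    have PB: "P \<in> ?B"
      unfolding P_def using inv H by (intro commutantI proj_op_commute[OF W]) auto
    have PP: "A \<bullet> P = (A ** P) \<bullet> P" for A
      by (simp add: inner_mm_right P_def cadjoint_proj_op W proj_op_idem)
    have "P *v f = f"
      unfolding P_def by (rule proj_op_id[OF W fW])
    then have P0: "P \<noteq> 0"
      using f by auto
    have "Z *v (P *v v) = l *\<^sub>R (P *v v)" for v
      using proj_op_in[OF W, of v] by (simp add: P_def W_def smult)
    then have "(Z ** P) *v v = (l *\<^sub>R P) *v v" for v
      by (simp add: scaleR_mult_vec flip: matrix_vector_mul_assoc)
    then have "Z ** P = l *\<^sub>R P"
      by (simp only: matrix_eq) simp
    then have "Z \<bullet> P = l * (P \<bullet> P)"
      by (subst PP) simp
    also have "\<dots> < 0"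
      using f P0 by (simp add: mult_neg_pos)
    \<comment> \<open>By \<open>PP\<close> this is the sum of \<open>v \<bullet> (X *v v)\<close>
      over the columns \<open>v\<close> of \<open>P\<close>.\<close>
    also have "0 \<le> X \<bullet> P"
      by (subst PP) (auto simp: inner_op_columns column_mm inner_commute
          intro!: sum_nonneg positive_op_inner_nonneg X)
    also have "X \<bullet> P = Z \<bullet> P"
      using orth_proj_orth[OF B PB, of X] by (simp add: Z_def inner_diff_left)
    finally show False
      by simp
  qed
  then show ?thesis
    using Zh by (simp add: positive_op_iff Z_def)
qed

section \<open>Matrix units and the bicommutant theorem\<close>

definition unit_op :: "'n \<Rightarrow> 'n \<Rightarrow> ('n::finite) op" where
  "unit_op k l = (\<chi> i j. if i = k then if j = l then 1 else 0 else 0)"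

lemma op_as_sum: "X = (\<Sum>k\<in>UNIV. \<Sum>l\<in>UNIV. cscale (X $ k $ l) (unit_op k l))"
proof -
  have "(\<Sum>l\<in>UNIV. X $ k $ l * (if i = k then if j = l then 1 else 0 else 0)) =
      (if i = k then X $ k $ j else 0)" for i j k
    by (simp add: mult_delta_right)
  then show ?thesis
    by (simp add: vec_eq_iff cscale_def unit_op_def)
qed

lemma mm_unit_op: "X ** unit_op k l = (\<Sum>m\<in>UNIV. cscale (X $ m $ k) (unit_op m l))"
proof -
  have "(\<Sum>m\<in>UNIV. X $ i $ m * (if m = k then if j = l then 1 else 0 else 0)) =
      (\<Sum>m\<in>UNIV. X $ m $ k * (if i = m then if j = l then 1 else 0 else 0))" for i j
    by (simp add: mult_delta_right)
  then show ?thesis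
    by (simp add: vec_eq_iff cscale_def unit_op_def matrix_matrix_mult_def)
qed

lemma mat_1_as_sum: "mat 1 = (\<Sum>k\<in>UNIV. unit_op k k)"
proof -
  have "(\<Sum>k\<in>UNIV. if i = k then if j = k then 1 else (0 :: complex) else 0) = (if i = j then 1 else 0)" for i j :: 'a
    by simp
  then show ?thesis
    by (simp add: vec_eq_iff unit_op_def mat_def)
qed

text \<open>The orthogonal projection \<open>E\<close> onto \<open>\<A>\<close> commutes with left multiplication by \<open>\<A>\<close>, so the
  matrices \<open>Q j l\<close> with entries \<open>E (unit_op k l) $ i $ j\<close> lie in the commutant of \<open>\<A>\<close>.
  Hence \<open>E\<close> also commutes with left multiplication by the bicommutant.\<close>

theorem bicommutant:
  assumes vN: "von_neumann_algebra \<A>"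
  shows "commutant (commutant \<A>) = \<A>"
proof
  show "\<A> \<subseteq> commutant (commutant \<A>)"
    by (auto simp: commutant_def)
  have A: "subspace \<A>"
    by (intro subspace_of_cmat_subspace vN_subspace vN)
  define E where "E = orth_proj \<A>"
  have E_linear: "linear E"
    unfolding E_def by (rule linear_orth_proj[OF A])
  have E_cscale: "E (cscale c X) = cscale c (E X)" for c X
    unfolding E_def by (rule orth_proj_cscale[OF vN_subspace[OF vN]])
  define Q where "Q j l = (\<chi> i k. E (unit_op k l) $ i $ j)" for j l
  have QX: "(Q j l ** X) $ i $ k = E (X ** unit_op k l) $ i $ j" for X i j k l
    unfolding mm_unit_op linear_sum[OF E_linear] E_cscale
    by (simp add: Q_def matrix_matrix_mult_def cscale_def mult.commute)
  have XQ: "(X ** Q j l) $ i $ k = (X ** E (unit_op k l)) $ i $ j" for X i j k l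
    by (simp add: Q_def matrix_matrix_mult_def)
  have Q: "Q j l \<in> commutant \<A>" for j l
  proof (rule commutantI)
    fix X assume X: "X \<in> \<A>"
    have "E (X ** Y) = X ** E Y" for Y
      unfolding E_def using X vN
      by (intro orth_proj_commute[where g = "\<lambda>Y. cadjoint X ** Y"])
        (auto simp: A linear_mm_left inner_mm_left vN_mult vN_adjoint)
    then show "Q j l ** X = X ** Q j l"
      by (simp add: vec_eq_iff QX XQ)
  qed
  show "commutant (commutant \<A>) \<subseteq> \<A>"
  proof
    fix X assume X: "X \<in> commutant (commutant \<A>)"
    have "E (X ** unit_op k l) = X ** E (unit_op k l)" for k l
      using commutantD[OF X Q] by (simp add: vec_eq_iff flip: QX XQ)
    \<comment> \<open>Summing over the diagonal units gives \<open>E X = X\<close>, because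
      \<open>E\<close> fixes \<open>mat 1\<close>.\<close>
    then have "E (X ** mat 1) = X ** E (mat 1)"
      by (simp add: mat_1_as_sum linear_sum[OF E_linear] linear_sum[OF linear_mm_left] del: matrix_mul_rid)
    also have "E (mat 1) = mat 1"
      unfolding E_def by (rule orth_proj_id[OF A vN_1[OF vN]])
    finally show "X \<in> \<A>"
      using orth_proj_in[OF A, of X] by (simp add: E_def)
  qed
qed

section \<open>Schur-Weyl duality\<close>

lemma tensor_op_mult: "tensor_op A B ** tensor_op C D = tensor_op (A ** C) (B ** D)"
proof -
  have "(tensor_op A B ** tensor_op C D) $ i $ j = tensor_op (A ** C) (B ** D) $ i $ j" for i j
  proof -
    have "(tensor_op A B ** tensor_op C D) $ i $ j =
        (\<Sum>k\<in>UNIV \<times> UNIV. (A $ fst i $ fst k * C $ fst k $ fst j) * (B $ snd i $ snd k * D $ snd k $ snd j))"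
      by (simp add: tensor_op_def matrix_matrix_mult_def mult_ac)
    also have "\<dots> = (\<Sum>k\<in>UNIV. A $ fst i $ k * C $ k $ fst j) * (\<Sum>k\<in>UNIV. B $ snd i $ k * D $ k $ snd j)"
      by (simp add: sum_product sum.cartesian_product' del: UNIV_Times_UNIV)
    finally show ?thesis
      by (simp add: tensor_op_def matrix_matrix_mult_def)
  qed
  then show ?thesis
    by (simp add: vec_eq_iff)
qed

lemma cadjoint_tensor_op: "cadjoint (tensor_op A B) = tensor_op (cadjoint A) (cadjoint B)"
  by (simp add: cadjoint_def tensor_op_def vec_eq_iff)

lemma tensor_op_1: "tensor_op (mat 1) (mat 1) = mat 1"
  by (auto simp: tensor_op_def mat_def vec_eq_iff)

lemma tensor_op_add_left: "tensor_op (A + B) C = tensor_op A C + tensor_op B C"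
  by (simp add: tensor_op_def vec_eq_iff distrib_right)

lemma tensor_op_add_right: "tensor_op A (B + C) = tensor_op A B + tensor_op A C"
  by (simp add: tensor_op_def vec_eq_iff distrib_left)

lemma tensor_op_diff_left: "tensor_op (A - B) C = tensor_op A C - tensor_op B C"
  by (simp add: tensor_op_def vec_eq_iff left_diff_distrib)

lemma tensor_op_diff_right: "tensor_op A (B - C) = tensor_op A B - tensor_op A C"
  by (simp add: tensor_op_def vec_eq_iff right_diff_distrib)

lemma tensor_op_cscale_left: "tensor_op (cscale c A) B = cscale c (tensor_op A B)"
  by (simp add: tensor_op_def cscale_def vec_eq_iff)

lemma tensor_op_cscale_right: "tensor_op A (cscale c B) = cscale c (tensor_op A B)"
  by (simp add: tensor_op_def cscale_def vec_eq_iff)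

lemmas tensor_op_simps = tensor_op_add_left tensor_op_add_right tensor_op_diff_left
  tensor_op_diff_right tensor_op_cscale_left tensor_op_cscale_right

lemma Swap_mult_nth: "(Swap ** X) $ i $ j = X $ prod.swap i $ j"
  unfolding Swap_def matrix_matrix_mult_def by (simp add: if_distrib if_distribR cong: if_cong)

lemma mult_Swap_nth: "(X ** Swap) $ i $ j = X $ i $ prod.swap j"
proof -
  have "(j = prod.swap k) = (k = prod.swap j)" for k
    by (metis swap_swap)
  then show ?thesis
    unfolding Swap_def matrix_matrix_mult_def by (simp add: if_distrib if_distribR cong: if_cong)
qed

lemma Swap_Swap: "Swap ** Swap = mat 1"
  by (auto simp: vec_eq_iff Swap_mult_nth) (auto simp: Swap_def mat_def)

lemma Swap_Swap_mult: "Swap ** (Swap ** X) = X"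
  by (simp add: matrix_mul_assoc Swap_Swap)

lemma mult_Swap_Swap: "X ** Swap ** Swap = X"
  by (simp add: Swap_Swap flip: matrix_mul_assoc)

lemma cadjoint_Swap: "cadjoint Swap = Swap"
  by (auto simp: vec_eq_iff cadjoint_def Swap_def)

lemma unitary_Swap: "unitary Swap"
  by (simp add: unitary_def cadjoint_Swap Swap_Swap)

lemma Swap_tensor_op_Swap: "Swap ** tensor_op A B ** Swap = tensor_op B A"
  by (simp add: vec_eq_iff mult_Swap_nth Swap_mult_nth tensor_op_def mult.commute)

text \<open>The twist \<open>g\<close> of the scalars admits conjugate-linear maps:
  \<open>g = cnj\<close> covers the adjoint.\<close>

lemma cmat_span_closed:
  assumes X: "X \<in> cmat.span S" and T: "cmat.subspace T" and base: "\<And>x. x \<in> S \<Longrightarrow> f x \<in> T"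
    and f: "f 0 = 0" "\<And>x y. f (x + y) = f x + f y" "\<And>c x. f (cscale c x) = cscale (g c) (f x)"
  shows "f X \<in> T"
  using X
proof (rule cmat.span_induct)
  show "cmat.subspace {X. f X \<in> T}"
    using T by (simp add: cmat.subspace_def f)
qed (use base in auto)

lemma tensor_op_in_tensor_square: "X \<in> \<A> \<Longrightarrow> Y \<in> \<A> \<Longrightarrow> tensor_op X Y \<in> tensor_square \<A>"
  unfolding tensor_square_def by (rule cmat.span_base) blast

lemma subspace_tensor_square: "cmat.subspace (tensor_square \<A>)"
  by (simp add: tensor_square_def)

lemma Swap_conj_tensor_square:
  assumes "X \<in> tensor_square \<A>"
  shows "Swap ** X ** Swap \<in> tensor_square \<A>"
  using assms unfolding tensor_square_def
  by (rule cmat_span_closed[where g = id])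
    (auto simp: mm_simps Swap_tensor_op_Swap
      intro!: tensor_op_in_tensor_square[unfolded tensor_square_def])

lemma von_neumann_algebra_tensor_square:
  assumes vN: "von_neumann_algebra \<A>"
  shows "von_neumann_algebra (tensor_square \<A>)"
  unfolding von_neumann_algebra_def
proof (intro conjI ballI)
  let ?S = "{tensor_op X Y |X Y. X \<in> \<A> \<and> Y \<in> \<A>}"
  show "cmat.subspace (tensor_square \<A>)"
    by (rule subspace_tensor_square)
  show "mat 1 \<in> tensor_square \<A>"
    using vN_1[OF vN] by (simp add: tensor_op_in_tensor_square flip: tensor_op_1)
  show "cadjoint X \<in> tensor_square \<A>" if "X \<in> tensor_square \<A>" for X
    using that unfolding tensor_square_def
    by (rule cmat_span_closed[where g = cnj])
      (auto simp: cadjoint_simps cadjoint_tensor_op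
        intro!: tensor_op_in_tensor_square[unfolded tensor_square_def] vN_adjoint[OF vN])
  have mult: "X ** Y \<in> tensor_square \<A>" if X: "X \<in> ?S" and Y: "Y \<in> tensor_square \<A>" for X Y
    using Y unfolding tensor_square_def
    by (rule cmat_span_closed[where g = id])
      (use X in \<open>auto simp: mm_simps tensor_op_mult
        intro!: tensor_op_in_tensor_square[unfolded tensor_square_def] vN_mult[OF vN]\<close>)
  show "X ** Y \<in> tensor_square \<A>" if "X \<in> tensor_square \<A>" "Y \<in> tensor_square \<A>" for X Y
    by (rule cmat_span_closed[where g = id and f = "\<lambda>X. X ** Y", OF that(1)[unfolded tensor_square_def]])
      (use mult[OF _ that(2)] in \<open>auto simp: mm_simps subspace_tensor_square\<close>)
qed

text \<open>The blocks of an operator commuting with \<open>\<A> \<otimes> 1\<close> lie in the commutant of \<open>\<A>\<close>, and so do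
  those with respect to the other tensor factor; the latter are therefore fixed by the
  orthogonal projection \<open>E\<close> onto the commutant.\<close>

lemma commutant_tensor_square_subset:
  assumes vN: "von_neumann_algebra \<A>"
  shows "commutant (tensor_square \<A>) \<subseteq> tensor_square (commutant \<A>)"
proof
  fix N assume N: "N \<in> commutant (tensor_square \<A>)"
  let ?B = "commutant \<A>"
  have vNB: "von_neumann_algebra ?B"
    using vN_adjoint[OF vN] by (rule von_neumann_algebra_commutant)
  note B = subspace_of_cmat_subspace[OF vN_subspace[OF vNB]]
  define E where "E = orth_proj ?B"
  have E_linear: "linear E"
    unfolding E_def by (rule linear_orth_proj[OF B])
  have E_cscale: "E (cscale c X) = cscale c (E X)" for c X
    unfolding E_def by (rule orth_proj_cscale[OF vN_subspace[OF vNB]])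
  define N1 where "N1 j l = (\<chi> i k. N $ (i, j) $ (k, l))" for j l
  define N2 where "N2 i k = (\<chi> j l. N $ (i, j) $ (k, l))" for i k
  have sum_pair: "(\<Sum>p\<in>UNIV. g p) = (\<Sum>i\<in>UNIV. \<Sum>j\<in>UNIV. g (i, j))" for g :: "'a \<times> 'a \<Rightarrow> complex"
    by (simp add: sum.cartesian_product' flip: UNIV_Times_UNIV)
  have N1: "N1 j l \<in> ?B" for j l
  proof (rule commutantI)
    fix X assume "X \<in> \<A>"
    then have "N ** tensor_op X (mat 1) = tensor_op X (mat 1) ** N"
      by (intro commutantD[OF N] tensor_op_in_tensor_square vN_1[OF vN])
    then have "(N ** tensor_op X (mat 1)) $ (i, j) $ (k, l) = (tensor_op X (mat 1) ** N) $ (i, j) $ (k, l)" for i k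
      by simp
    then show "N1 j l ** X = X ** N1 j l"
      by (simp add: N1_def vec_eq_iff matrix_matrix_mult_def sum_pair tensor_op_def mat_def
          mult_delta_left mult_delta_right)
  qed
  have N2: "N2 i k \<in> ?B" for i k
  proof (rule commutantI)
    fix X assume "X \<in> \<A>"
    then have "N ** tensor_op (mat 1) X = tensor_op (mat 1) X ** N"
      by (intro commutantD[OF N] tensor_op_in_tensor_square vN_1[OF vN])
    then have "(N ** tensor_op (mat 1) X) $ (i, j) $ (k, l) = (tensor_op (mat 1) X ** N) $ (i, j) $ (k, l)" for j l
      by simp
    moreover have "(N ** tensor_op (mat 1) X) $ (i, j) $ (k, l) = (N2 i k ** X) $ j $ l" for j l
      unfolding matrix_matrix_mult_def N2_def tensor_op_def mat_def
      by (simp add: sum_pair mult_delta_left mult_delta_right) (subst sum.swap, simp)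
    moreover have "(tensor_op (mat 1) X ** N) $ (i, j) $ (k, l) = (X ** N2 i k) $ j $ l" for j l
      unfolding matrix_matrix_mult_def N2_def tensor_op_def mat_def
      by (simp add: sum_pair mult_delta_left mult_delta_right) (subst sum.swap, simp)
    ultimately show "N2 i k ** X = X ** N2 i k"
      by (simp add: vec_eq_iff)
  qed
  \<comment> \<open>\<open>N\<close> is the sum of all
    \<open>tensor_op (N1 j' l') (unit_op j' l')\<close>. Expanding
    \<open>N2 i k = E (N2 i k)\<close> in matrix units replaces each unit by its image under
    \<open>E\<close>, which lies in the commutant.\<close>
  have "N $ (i, j) $ (k, l) =
      (\<Sum>j'\<in>UNIV. \<Sum>l'\<in>UNIV. tensor_op (N1 j' l') (E (unit_op j' l'))) $ (i, j) $ (k, l)" for i j k l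
  proof -
    have "N $ (i, j) $ (k, l) = E (N2 i k) $ j $ l"
      using N2 by (simp add: E_def orth_proj_id[OF B]) (simp add: N2_def)
    also have "E (N2 i k) = (\<Sum>j'\<in>UNIV. \<Sum>l'\<in>UNIV. cscale (N2 i k $ j' $ l') (E (unit_op j' l')))"
      by (subst op_as_sum[of "N2 i k"]) (simp only: linear_sum[OF E_linear] E_cscale)
    finally show ?thesis
      by (simp add: cscale_def tensor_op_def N1_def N2_def)
  qed
  then have "N = (\<Sum>j'\<in>UNIV. \<Sum>l'\<in>UNIV. tensor_op (N1 j' l') (E (unit_op j' l')))"
    by (simp only: vec_eq_iff split_paired_all) simp
  also have "\<dots> \<in> tensor_square ?B"
    using N1 orth_proj_in[OF B]
    by (intro cmat.subspace_sum subspace_tensor_square tensor_op_in_tensor_square) (auto simp: E_def)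
  finally show "N \<in> tensor_square ?B" .
qed

text \<open>\<open>V\<close> is the Cayley transform of \<open>h\<close>, a rational substitute for
  an exponential. A vector killed by \<open>D\<close> satisfies \<open>v = \<i> *s (h *v v)\<close>,
  which is impossible for nonzero \<open>v\<close> as \<open>h\<close> is Hermitian; so
  \<open>D\<close> is invertible. The equations with \<open>D\<close> on either side allow
  denominators to be cleared later.\<close>

lemma cayley_transform:
  assumes h: "cadjoint h = h"
  defines "C \<equiv> mat 1 + cscale \<i> h" and "D \<equiv> mat 1 - cscale \<i> h"
  obtains V where "unitary V" "V ** D = C" "D ** V = C"
    "\<And>X. X ** h = h ** X \<Longrightarrow> X ** V = V ** X"
proof -
  have "v = 0" if "D *v v = 0" for v
  proof -
    have v: "v = \<i> *s (h *v v)"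
      using that by (simp add: D_def matrix_vector_mult_diff_rdistrib cscale_mult_vec)
    have skew: "(\<i> *s w) \<bullet> v = - ((\<i> *s v) \<bullet> w)" for w
      by (simp add: inner_vec_def inner_complex_def algebra_simps flip: sum_negf)
    have "(\<i> *s (h *v v)) \<bullet> v = (h *v (\<i> *s v)) \<bullet> v"
      by (simp add: vector_scalar_commute)
    also have "\<dots> = - ((\<i> *s (h *v v)) \<bullet> v)"
      unfolding inner_mult_vec h skew[of "h *v v"] by simp
    finally have "(\<i> *s (h *v v)) \<bullet> v = 0"
      by simp
    then have "v \<bullet> v = 0"
      by (simp flip: v)
    then show ?thesis
      by simp
  qed
  then obtain B where BD: "B ** D = mat 1"
    using matrix_left_invertible_ker[of D] by blast
  then have DB: "D ** B = mat 1"
    by (simp add: matrix_left_right_inverse)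
  have CD: "C ** D = D ** C"
    by (simp add: C_def D_def mm_simps cmat.scale_right_distrib cmat.scale_right_diff_distrib)
  have adj: "cadjoint C = D" "cadjoint D = C"
    by (simp_all add: C_def D_def cadjoint_simps h)
  define V where "V = B ** C"
  have VD: "V ** D = C"
    by (simp add: V_def CD BD flip: matrix_mul_assoc) (simp add: BD matrix_mul_assoc)
  have DV: "D ** V = C"
    by (simp add: V_def matrix_mul_assoc DB)
  have "V ** cadjoint V = V ** D ** cadjoint B"
    by (simp add: V_def cadjoint_mult adj matrix_mul_assoc)
  also have "\<dots> = cadjoint (B ** D)"
    by (simp add: VD cadjoint_mult adj)
  finally have "V ** cadjoint V = mat 1"
    by (simp add: BD)
  then have "unitary V"
    unfolding unitary_def by (simp add: matrix_left_right_inverse)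
  moreover have "X ** V = V ** X" if X: "X ** h = h ** X" for X
  proof -
    have XC: "X ** C = C ** X" and XD: "X ** D = D ** X"
      by (simp_all add: C_def D_def mm_simps X)
    have "X ** V = B ** (D ** X) ** V"
      by (simp add: matrix_mul_assoc BD)
    also have "\<dots> = B ** X ** (D ** V)"
      by (simp add: XD[symmetric] matrix_mul_assoc)
    also have "\<dots> = B ** (C ** X)"
      by (simp only: DV XC flip: matrix_mul_assoc)
    also have "\<dots> = V ** X"
      by (simp add: V_def matrix_mul_assoc)
    finally show ?thesis .
  qed
  ultimately show ?thesis
    using that VD DV by blast
qed

text \<open>The infinitesimal form of \<open>tensor_op V V\<close>: its derivative at
  \<open>V = mat 1\<close> in the direction \<open>a\<close>.\<close>

abbreviation sym_tensor :: "('d::finite) op \<Rightarrow> ('d \<times> 'd) op" where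
  "sym_tensor a \<equiv> tensor_op a (mat 1) + tensor_op (mat 1) a"

text \<open>Commuting with the Cayley transforms of \<open>t h\<close> for \<open>t = 1\<close> and \<open>t = 2\<close> suffices to
  separate the terms of order \<open>t\<close> and \<open>t\<^sup>3\<close>.\<close>

lemma commute_sym_tensor_hermitian:
  assumes M: "M \<in> commutant (collective (gauge_group \<A>))"
    and h: "h \<in> commutant \<A>" "cadjoint h = h"
  shows "M ** sym_tensor h = sym_tensor h ** M"
proof -
  \<comment> \<open>\<open>tensor_op C C\<close> and \<open>tensor_op D D\<close> are
    \<open>a + x\<close> and \<open>a - x\<close>. Multiplying the commutation of \<open>M\<close>
    with \<open>tensor_op V V\<close> by \<open>a - x\<close> on both sides clears the denominators,
    and the terms \<open>a M a\<close> and \<open>x M x\<close> cancel.\<close>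
  have key: "(mat 1 - tensor_op g g) ** M ** cscale \<i> (sym_tensor g) =
      cscale \<i> (sym_tensor g) ** M ** (mat 1 - tensor_op g g)"
    if g: "g \<in> commutant \<A>" "cadjoint g = g" for g
  proof -
    define C where "C = mat 1 + cscale \<i> g"
    define D where "D = mat 1 - cscale \<i> g"
    define a where "a = mat 1 - tensor_op g g"
    define x where "x = cscale \<i> (sym_tensor g)"
    obtain V where V: "unitary V" "V ** D = C" "D ** V = C"
        "\<And>X. X ** g = g ** X \<Longrightarrow> X ** V = V ** X"
      using cayley_transform[OF g(2)] unfolding C_def D_def by blast
    have "V \<in> gauge_group \<A>"
      using V(1,4) commutantD[OF g(1)] by (simp add: gauge_group_def)
    then have MV: "M ** tensor_op V V = tensor_op V V ** M"
      by (intro commutantD[OF M]) (auto simp: collective_def)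
    have CC: "tensor_op C C = a + x" and DD: "tensor_op D D = a - x"
      unfolding C_def D_def a_def x_def
      by (simp_all add: tensor_op_simps tensor_op_1) (simp_all add: vec_eq_iff cscale_def algebra_simps)
    have "(a - x) ** M ** (a + x) = tensor_op D D ** (M ** tensor_op V V) ** tensor_op D D"
      by (simp add: tensor_op_mult V(2) flip: CC DD matrix_mul_assoc)
    also have "\<dots> = (a + x) ** M ** (a - x)"
      unfolding MV by (simp add: tensor_op_mult V(3) matrix_mul_assoc flip: CC DD)
    finally have "2 *\<^sub>R (a ** M ** x) = 2 *\<^sub>R (x ** M ** a)"
      by (simp add: mm_simps scaleR_2 algebra_simps)
    then show ?thesis
      by (simp add: a_def x_def)
  qed
  define x where "x = cscale \<i> (sym_tensor h)"
  define L where "L = tensor_op h h"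
  have 1: "M ** x - L ** M ** x = x ** M - x ** M ** L"
    using key[OF h] by (simp add: mm_diff_left mm_diff_right x_def L_def)
  have h2: "cscale 2 h \<in> commutant \<A>" "cadjoint (cscale 2 h) = cscale 2 h"
    using h by (auto simp: commutant_def mm_simps cadjoint_cscale)
  have scl: "cscale \<i> (sym_tensor (cscale 2 h)) = 2 *\<^sub>R x" "tensor_op (cscale 2 h) (cscale 2 h) = 4 *\<^sub>R L"
    by (simp_all add: x_def L_def tensor_op_simps scaleR_eq_cscale) (simp add: cscale_def vec_eq_iff)+
  have sm: "(r *\<^sub>R A) ** B = r *\<^sub>R (A ** B)" "A ** (r *\<^sub>R B) = r *\<^sub>R (A ** B)" for r and A B :: "('a \<times> 'a) op"
    by (simp_all add: scaleR_eq_cscale mm_simps)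
  have 2: "2 *\<^sub>R (M ** x) - 8 *\<^sub>R (L ** M ** x) = 2 *\<^sub>R (x ** M) - 8 *\<^sub>R (x ** M ** L)"
    using key[OF h2] unfolding scl by (simp add: mm_diff_left mm_diff_right sm scaleR_diff_right)
  \<comment> \<open>Doubling \<open>h\<close> scales the cubic terms by 8 and the linear ones by 2.
    Eight times equation \<open>1\<close> minus equation \<open>2\<close> therefore leaves the
    linear terms with factor 6.\<close>
  have "6 *\<^sub>R (M ** x) = 8 *\<^sub>R (M ** x - L ** M ** x) - (2 *\<^sub>R (M ** x) - 8 *\<^sub>R (L ** M ** x))"
    by (simp add: scaleR_diff_right flip: scaleR_diff_left)
  also have "\<dots> = 6 *\<^sub>R (x ** M)"
    unfolding 1 2 by (simp add: scaleR_diff_right flip: scaleR_diff_left)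
  finally have "cscale \<i> (M ** sym_tensor h) = cscale \<i> (sym_tensor h ** M)"
    by (simp add: x_def mm_cscale_left mm_cscale_right)
  then show ?thesis
    by (simp add: cscale_def vec_eq_iff)
qed

text \<open>The claim is complex linear in \<open>a\<close>, and the commutant, being closed under
  adjoints, is spanned by its Hermitian elements.\<close>

lemma commute_sym_tensor:
  assumes vN: "von_neumann_algebra \<A>" and M: "M \<in> commutant (collective (gauge_group \<A>))"
    and a: "a \<in> commutant \<A>"
  shows "M ** sym_tensor a = sym_tensor a ** M"
proof -
  have vN': "von_neumann_algebra (commutant \<A>)"
    using vN_adjoint[OF vN] by (rule von_neumann_algebra_commutant)
  define h where "h = a + cadjoint a"
  define k where "k = cscale \<i> (a - cadjoint a)"
  have hk: "h \<in> commutant \<A>" "k \<in> commutant \<A>"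
    using a vN' by (simp_all add: h_def k_def vN_add vN_diff vN_cscale vN_adjoint)
  have "cadjoint h = h" "cadjoint k = k"
    by (simp_all add: h_def k_def cadjoint_simps add.commute) (simp add: cscale_def vec_eq_iff algebra_simps)
  then have comm: "M ** sym_tensor h = sym_tensor h ** M" "M ** sym_tensor k = sym_tensor k ** M"
    using hk by (simp_all only: commute_sym_tensor_hermitian[OF M])
  have "a = cscale (1/2) h + cscale (- \<i> / 2) k"
    by (simp add: h_def k_def cscale_def vec_eq_iff field_simps)
  then have a: "sym_tensor a = cscale (1/2) (sym_tensor h) + cscale (- \<i> / 2) (sym_tensor k)"
    by (simp add: tensor_op_simps cmat.scale_right_distrib)
  show ?thesis
    unfolding a by (simp only: matrix_add_ldistrib[of M "cscale _ _"] mm_add_left[of "cscale _ _"]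
        mm_cscale_left mm_cscale_right comm)
qed

text \<open>A generalization of Schur-Weyl duality: the operators \<open>X + Swap Y\<close> form a von Neumann
  algebra with commutant the symmetric elements of the tensor square of the commutant of \<open>\<A>\<close>.\<close>

theorem schur_weyl:
  assumes vN: "von_neumann_algebra \<A>" and M: "M \<in> commutant (collective (gauge_group \<A>))"
    and MS: "M ** Swap = Swap ** M"
  obtains X Y where "X \<in> tensor_square \<A>" "Y \<in> tensor_square \<A>" "M = X + Swap ** Y"
proof -
  define C where "C = {X + Swap ** Y |X Y. X \<in> tensor_square \<A> \<and> Y \<in> tensor_square \<A>}"
  have vN': "von_neumann_algebra (commutant \<A>)"
    using vN_adjoint[OF vN] by (rule von_neumann_algebra_commutant)
  note vN2 = von_neumann_algebra_tensor_square[OF vN]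
  have zero: "0 \<in> tensor_square \<A>"
    using cmat.subspace_0[OF subspace_tensor_square] .
  have CI: "X + Swap ** Y \<in> C" if "X \<in> tensor_square \<A>" "Y \<in> tensor_square \<A>" for X Y
    using that by (auto simp: C_def)
  have vNC: "von_neumann_algebra C"
    unfolding von_neumann_algebra_def
  proof (intro conjI ballI)
    have "0 \<in> C"
      using CI[OF zero zero] by (simp add: mm_zero_right)
    moreover have "x + y \<in> C" if xy: "x \<in> C" "y \<in> C" for x y
    proof -
      obtain X Y X' Y' where "X \<in> tensor_square \<A>" "Y \<in> tensor_square \<A>" "x = X + Swap ** Y"
          "X' \<in> tensor_square \<A>" "Y' \<in> tensor_square \<A>" "y = X' + Swap ** Y'"
        using xy unfolding C_def by blast
      then show ?thesis
        using CI[of "X + X'" "Y + Y'"] vN2 by (simp add: vN_add matrix_add_ldistrib algebra_simps)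
    qed
    moreover have "cscale c x \<in> C" if x: "x \<in> C" for c x
    proof -
      obtain X Y where "X \<in> tensor_square \<A>" "Y \<in> tensor_square \<A>" "x = X + Swap ** Y"
        using x unfolding C_def by blast
      then show ?thesis
        using CI[of "cscale c X" "cscale c Y"] vN2
        by (simp add: vN_cscale mm_cscale_right cmat.scale_right_distrib)
    qed
    ultimately show "cmat.subspace C"
      by (simp add: cmat.subspace_def)
    show "mat 1 \<in> C"
      using CI[OF vN_1[OF vN2] zero] by (simp add: mm_zero_right)
    show "x ** y \<in> C" if xy: "x \<in> C" "y \<in> C" for x y
    proof -
      obtain X Y X' Y' where XY: "X \<in> tensor_square \<A>" "Y \<in> tensor_square \<A>" "x = X + Swap ** Y"
          "X' \<in> tensor_square \<A>" "Y' \<in> tensor_square \<A>" "y = X' + Swap ** Y'"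
        using xy unfolding C_def by blast
      \<comment> \<open>Each \<open>Swap\<close> between elements of the tensor square is moved to
        the left, at the price of a conjugation that preserves the tensor square.\<close>
      have "(X ** X' + Swap ** Y ** Swap ** Y') + Swap ** (Swap ** X ** Swap ** Y' + Y ** X') \<in> C"
        using XY by (intro CI vN_add[OF vN2] vN_mult[OF vN2] Swap_conj_tensor_square)
      also have "(X ** X' + Swap ** Y ** Swap ** Y') + Swap ** (Swap ** X ** Swap ** Y' + Y ** X') = x ** y"
        by (simp add: XY mm_simps matrix_mul_assoc Swap_Swap algebra_simps)
      finally show ?thesis .
    qed
    show "cadjoint x \<in> C" if x: "x \<in> C" for x
    proof -
      obtain X Y where XY: "X \<in> tensor_square \<A>" "Y \<in> tensor_square \<A>" "x = X + Swap ** Y"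
        using x unfolding C_def by blast
      have "cadjoint X + Swap ** (Swap ** cadjoint Y ** Swap) \<in> C"
        using XY by (intro CI vN_adjoint[OF vN2] Swap_conj_tensor_square)
      also have "cadjoint X + Swap ** (Swap ** cadjoint Y ** Swap) = cadjoint x"
        by (simp add: XY cadjoint_simps cadjoint_Swap matrix_mul_assoc Swap_Swap)
      finally show ?thesis .
    qed
  qed
  have sym: "M ** (N + Swap ** N ** Swap) = (N + Swap ** N ** Swap) ** M"
    if "N \<in> tensor_square (commutant \<A>)" for N
    using that unfolding tensor_square_def
  proof (rule cmat.span_induct)
    show "cmat.subspace {N. M ** (N + Swap ** N ** Swap) = (N + Swap ** N ** Swap) ** M}"
      by (auto simp: cmat.subspace_def mm_simps algebra_simps simp flip: cmat.scale_right_distrib)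
    fix N assume "N \<in> {tensor_op X Y |X Y. X \<in> commutant \<A> \<and> Y \<in> commutant \<A>}"
    then obtain a b where ab: "a \<in> commutant \<A>" "b \<in> commutant \<A>" "N = tensor_op a b"
      by blast
    \<comment> \<open>Polarization: \<open>sym_tensor a ** sym_tensor b\<close> consists of the
      symmetrization of \<open>tensor_op a b\<close> and of \<open>sym_tensor (a ** b)\<close>, so
      symmetrized tensors are generated by operators known to commute with \<open>M\<close>.\<close>
    have N: "N + Swap ** N ** Swap = sym_tensor a ** sym_tensor b - sym_tensor (a ** b)"
      by (simp add: ab Swap_tensor_op_Swap mm_simps tensor_op_mult algebra_simps)
    have a: "M ** sym_tensor a = sym_tensor a ** M" and b: "M ** sym_tensor b = sym_tensor b ** M"
      and c: "M ** sym_tensor (a ** b) = sym_tensor (a ** b) ** M"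
      by (rule commute_sym_tensor[OF vN M] ab vN_mult[OF vN'])+
    have "M ** (sym_tensor a ** sym_tensor b) = sym_tensor a ** sym_tensor b ** M"
      using a b by (rule commutes_mult)
    then show "M ** (N + Swap ** N ** Swap) = (N + Swap ** N ** Swap) ** M"
      using c unfolding N mm_diff_left mm_diff_right by (rule arg_cong2[where f = minus])
  qed
  have "M \<in> commutant (commutant C)"
  proof (rule commutantI)
    fix N assume N: "N \<in> commutant C"
    have "N \<in> commutant (tensor_square \<A>)"
    proof (rule commutantI)
      fix X assume "X \<in> tensor_square \<A>"
      from commutantD[OF N CI[OF this zero]] show "N ** X = X ** N"
        by (simp add: mm_zero_right)
    qed
    then have NT: "N \<in> tensor_square (commutant \<A>)"
      using commutant_tensor_square_subset[OF vN] by blast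
    have "N ** Swap = Swap ** N"
      using commutantD[OF N CI[OF zero vN_1[OF vN2]]] by simp
    then have "Swap ** N ** Swap = N"
      by (simp add: Swap_Swap_mult flip: matrix_mul_assoc)
    with sym[OF NT] have "2 *\<^sub>R (M ** N) = 2 *\<^sub>R (N ** M)"
      by (simp only: matrix_add_ldistrib mm_add_left scaleR_2)
    then show "M ** N = N ** M"
      by simp
  qed
  then have "M \<in> C"
    by (simp only: bicommutant[OF vNC])
  then show ?thesis
    using that unfolding C_def by blast
qed

section \<open>Lifting the swap blocks\<close>

lemma positive_op_add: "positive_op X \<Longrightarrow> positive_op Y \<Longrightarrow> positive_op (X + Y)"
  by (simp add: positive_op_iff cadjoint_add matrix_vector_mult_add_rdistrib inner_add_right)

lemma positive_op_scaleR: "positive_op X \<Longrightarrow> 0 \<le> r \<Longrightarrow> positive_op (r *\<^sub>R X)"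
  by (simp add: positive_op_iff scaleR_mult_vec) (simp add: scaleR_eq_cscale cadjoint_cscale)

lemma positive_op_conj_by: "positive_op X \<Longrightarrow> positive_op (conj_by V X)"
proof -
  have "x \<bullet> (conj_by V X *v x) = (cadjoint V *v x) \<bullet> (X *v (cadjoint V *v x))" for x
    by (simp add: conj_by_def inner_mult_vec matrix_vector_mul_assoc matrix_mul_assoc)
  then show "positive_op X \<Longrightarrow> positive_op (conj_by V X)"
    by (simp add: positive_op_iff) (simp add: conj_by_def cadjoint_mult matrix_mul_assoc)
qed

lemma positive_op_projection:
  assumes "P ** P = P" "cadjoint P = P"
  shows "positive_op P"
proof -
  have "x \<bullet> (P *v x) = (P *v x) \<bullet> (P *v x)" for x
    by (simp add: inner_mult_vec assms matrix_vector_mul_assoc)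
  then show ?thesis
    by (simp add: positive_op_iff assms)
qed

text \<open>In finite dimension \<open>F\<close> is bounded and so passes through countable
  sums.\<close>

lemma POVM_linear_image:
  assumes M: "POVM \<Omega> \<Sigma> M" and F: "linear F" "F (mat 1) = mat 1"
    and pos: "\<And>B. B \<in> \<Sigma> \<Longrightarrow> positive_op (F (M B))"
  shows "POVM \<Omega> \<Sigma> (\<lambda>B. F (M B))"
  using M F pos bounded_linear.sums[of F]
  by (auto simp: POVM_def linear_conv_bounded_linear)

text \<open>The complement of \<open>P\<close> projects onto the largest subspace on which \<open>R n\<close> vanishes for all
  \<open>n\<close> in the commutant of \<open>\<B>\<close>. A negative eigenvector of \<open>T\<close> in the range of \<open>P\<close> would be
  mapped by some \<open>R n\<close> to a negative eigenvector in the range of \<open>R\<close>. Elements of \<open>\<B> P\<close> are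
  determined by their product with \<open>R\<close>, which yields \<open>F\<close>.\<close>

lemma compression_lift:
  fixes \<B> :: "('n::finite) op set"
  assumes vN: "von_neumann_algebra \<B>" and R: "R ** R = R" "cadjoint R = R"
  obtains P F where "P \<in> \<B>" "P ** P = P" "cadjoint P = P" "P ** R = R" "linear F"
    "\<And>T. T \<in> \<B> \<Longrightarrow> F (T ** R) = T ** P"
    "\<And>T. T \<in> \<B> \<Longrightarrow> cadjoint T = T \<Longrightarrow> T ** R = R ** T \<Longrightarrow> positive_op (T ** R) \<Longrightarrow>
      positive_op (T ** P)"
proof -
  let ?N = "commutant \<B>"
  have vNN: "von_neumann_algebra ?N"
    using vN_adjoint[OF vN] by (rule von_neumann_algebra_commutant)
  define W where "W = {f. \<forall>n\<in>?N. R *v (n *v f) = 0}"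
  have W: "vec.subspace W"
    by (simp add: vec.subspace_def W_def matrix_vector_right_distrib vector_scalar_commute)
  have NW: "n *v f \<in> W" if "n \<in> ?N" "f \<in> W" for n f
  proof -
    have "R *v (m *v (n *v f)) = R *v ((m ** n) *v f)" for m
      by (simp add: matrix_vector_mul_assoc matrix_mul_assoc)
    then show ?thesis
      using that(2) vN_mult[OF vNN _ that(1)] by (simp add: W_def)
  qed
  define Q where "Q = proj_op W"
  have Q: "Q ** Q = Q" "cadjoint Q = Q"
    unfolding Q_def by (simp_all add: W proj_op_idem cadjoint_proj_op)
  have "Q \<in> commutant ?N"
    unfolding Q_def
    by (rule commutantI, rule proj_op_commute[OF W]) (simp_all add: NW vN_adjoint[OF vNN])
  then have QB: "Q \<in> \<B>"
    by (simp only: bicommutant[OF vN])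
  have "R *v (Q *v f) = 0" for f
    using proj_op_in[OF W, of f] vN_1[OF vNN] by (force simp: W_def Q_def)
  then have "(R ** Q) *v f = 0 *v f" for f
    by (simp flip: matrix_vector_mul_assoc)
  then have "R ** Q = 0"
    by (simp only: matrix_eq) simp
  from arg_cong[OF this, of cadjoint] have QR: "Q ** R = 0"
    by (simp add: cadjoint_mult Q R cadjoint_zero)
  define P where "P = mat 1 - Q"
  have P: "P \<in> \<B>" "P ** P = P" "cadjoint P = P" "P ** R = R"
    using QB vN by (auto simp: P_def mm_simps cadjoint_simps Q QR vN_diff vN_1)
  define L where "L = {X \<in> \<B>. X ** P = X}"
  have TPL: "T ** P \<in> L" if "T \<in> \<B>" for T
    using that P vN by (simp add: L_def vN_mult flip: matrix_mul_assoc)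
  have L: "subspace L"
    using subspace_of_cmat_subspace[OF vN_subspace[OF vN]]
    by (auto simp: subspace_def L_def mm_simps scaleR_eq_cscale)
  have inj: "inj_on (\<lambda>X. X ** R) L"
  proof (rule linear_inj_on_iff_eq_0[OF linear_mm_right L, THEN iffD2], intro ballI impI)
    fix X assume X: "X \<in> L" "X ** R = 0"
    \<comment> \<open>In adjoint form: \<open>X\<close> annihilates what \<open>?N\<close> generates
      from the range of \<open>R\<close>. This gives \<open>X ** Q = X\<close>, while
      \<open>X ** P = X\<close> and \<open>P ** Q = 0\<close>.\<close>
    have "cadjoint X *v v \<in> W" for v
      unfolding W_def
    proof (intro CollectI ballI)
      fix n assume n: "n \<in> ?N"
      have "X ** cadjoint n ** R = cadjoint n ** (X ** R)"
        using commutantD[OF vN_adjoint[OF vNN n], of X] X(1) by (simp add: L_def matrix_mul_assoc)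
      from arg_cong[OF this, of cadjoint] have "R ** (n ** cadjoint X) = 0"
        by (simp add: X mm_zero_right cadjoint_mult R cadjoint_zero)
      then show "R *v (n *v (cadjoint X *v v)) = 0"
        by (simp add: matrix_vector_mul_assoc)
    qed
    from arg_cong[OF proj_op_mult_id[OF W this], of cadjoint] have "X ** Q = X"
      by (simp add: cadjoint_mult Q flip: Q_def)
    then show "X = 0"
      using X(1) by (simp add: L_def P_def mm_simps)
  qed
  \<comment> \<open>The left inverse is linear on all operators, with values prescribed only on the
    image of \<open>L\<close>.\<close>
  then obtain F where F: "linear F" "\<And>X. X \<in> L \<Longrightarrow> F (X ** R) = X"
    using linear_exists_left_inverse_on[OF linear_mm_right L] by blast
  have FT: "F (T ** R) = T ** P" if "T \<in> \<B>" for T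
    using F(2)[OF TPL[OF that]] P(4) by (simp flip: matrix_mul_assoc)
  have "positive_op (T ** P)"
    if T: "T \<in> \<B>" "cadjoint T = T" "T ** R = R ** T" and pos: "positive_op (T ** R)" for T
  proof -
    have TN: "n *v (T *v v) = T *v (n *v v)" if "n \<in> ?N" for n v
      using commutantD[OF that T(1)] by (simp add: matrix_vector_mul_assoc)
    have RT: "R *v (T *v v) = T *v (R *v v)" for v
      by (simp add: matrix_vector_mul_assoc T(3))
    have "T *v w \<in> W" if "w \<in> W" for w
      using that by (simp add: W_def TN RT)
    then have "Q ** T = T ** Q"
      unfolding Q_def by (intro proj_op_commute[OF W]) (simp_all add: T)
    then have PT: "P ** T = T ** P"
      by (simp add: P_def mm_simps)
    define U where "U = range ((*v) P)"
    have U: "P *v u = u" if "u \<in> U" for u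
      using that P(2) by (auto simp: U_def matrix_vector_mul_assoc)
    have sU: "subspace U"
      unfolding U_def by (intro linear_subspace_image subspace_UNIV) simp
    have "0 \<le> u \<bullet> (T *v u)" if u: "u \<in> U" for u
    proof (rule ccontr)
      assume "\<not> 0 \<le> u \<bullet> (T *v u)"
      moreover have "T *v w \<in> U" if "w \<in> U" for w
        using U[OF that] PT unfolding U_def
        by (metis matrix_vector_mul_assoc rangeI)
      ultimately obtain f l where f: "f \<in> U" "f \<noteq> 0" "l < 0" "T *v f = l *\<^sub>R f"
        using negative_eigenvector[of "(*v) T" U u] sU u by (auto simp: inner_mult_vec T)
      have "R *v (n *v f) = 0" if n: "n \<in> ?N" for n
      proof -
        define g where "g = R *v (n *v f)"
        have "T *v g = R *v (n *v (T *v f))"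
          by (simp add: g_def RT TN n)
        also have "\<dots> = l *\<^sub>R g"
          by (simp add: f g_def linear_scale[OF matrix_vector_mul_linear])
        finally have Tg: "T *v g = l *\<^sub>R g" .
        have "R *v g = g"
          by (simp add: g_def R matrix_vector_mul_assoc matrix_mul_assoc)
        then have "g \<bullet> ((T ** R) *v g) = l * (g \<bullet> g)"
          by (simp add: Tg flip: matrix_vector_mul_assoc)
        moreover have "0 \<le> g \<bullet> ((T ** R) *v g)"
          using pos by (rule positive_op_inner_nonneg)
        ultimately have "g \<bullet> g \<le> 0"
          using f(3) by (simp add: zero_le_mult_iff)
        then have "g = 0"
          by (metis inner_eq_zero_iff inner_ge_zero order_antisym)
        then show ?thesis
          by (simp add: g_def)
      qed
      then have "f \<in> W"
        by (simp add: W_def)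
      then have "P *v f = 0"
        by (simp add: P_def matrix_vector_mult_diff_rdistrib Q_def proj_op_id[OF W])
      then show False
        using U f by simp
    qed
    then have "0 \<le> (P *v x) \<bullet> (T *v (P *v x))" for x
      by (simp add: U_def)
    then have "0 \<le> x \<bullet> ((T ** P) *v x)" for x
      using PT P by (simp add: inner_mult_vec matrix_vector_mul_assoc matrix_mul_assoc)
        (simp add: P(2) flip: matrix_mul_assoc)
    then show ?thesis
      by (simp add: positive_op_iff cadjoint_mult T P PT)
  qed
  then show ?thesis
    using that P F(1) FT by blast
qed

text \<open>With \<open>c\<close> the eigenvalue of \<open>Swap\<close>, \<open>1\<close> or
  \<open>-1\<close>, one formula covers the symmetric and the antisymmetric case.\<close>

definition swap_projector :: "complex \<Rightarrow> ('d::finite \<times> 'd) op" where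
  "swap_projector c = cscale (1/2) (mat 1 + cscale c Swap)"

lemma Pi_plus_swap_projector: "Pi_plus = swap_projector 1"
  by (simp add: Pi_plus_eq swap_projector_def)

lemma Pi_minus_swap_projector: "Pi_minus = swap_projector (-1)"
  by (simp add: Pi_minus_eq swap_projector_def)

lemma Pi_plus_add_Pi_minus: "Pi_plus + Pi_minus = mat 1"
  by (simp add: Pi_plus_eq Pi_minus_eq cscale_def vec_eq_iff field_simps)

context
  fixes c :: complex
  assumes c: "c = 1 \<or> c = -1"
begin

lemma Swap_swap_projector: "Swap ** swap_projector c = cscale c (swap_projector c)"
  using c by (auto simp: swap_projector_def mm_simps Swap_Swap algebra_simps)

lemma swap_projector_idem: "swap_projector c ** swap_projector c = swap_projector c"
proof -
  have "swap_projector c ** swap_projector c =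
      cscale (1/2) (swap_projector c + cscale c (Swap ** swap_projector c))"
    by (subst (1) swap_projector_def) (simp add: mm_simps)
  also have "cscale c (Swap ** swap_projector c) = swap_projector c"
    using c by (auto simp: Swap_swap_projector)
  finally show ?thesis
    by (simp only: cscale_half_double)
qed

lemma cadjoint_swap_projector: "cadjoint (swap_projector c) = swap_projector c"
  using c by (auto simp: swap_projector_def cadjoint_simps cadjoint_Swap)

lemma swap_projector_commute: "X ** Swap = Swap ** X \<Longrightarrow> X ** swap_projector c = swap_projector c ** X"
  by (simp add: swap_projector_def mm_simps)

text \<open>The operator \<open>X + c Y\<close> need neither be Hermitian nor commute with the
  projector, as \<open>compression_lift\<close> requires. Averaging over conjugation by
  \<open>Swap\<close> and over the adjoint repairs both; the block is unchanged because
  \<open>M\<close> is fixed by both operations.\<close>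

lemma tensor_square_representative:
  assumes vN: "von_neumann_algebra \<A>" and M: "M \<in> commutant (collective (gauge_group \<A>))"
    and MS: "M ** Swap = Swap ** M" and Mh: "cadjoint M = M"
  obtains T where "T \<in> tensor_square \<A>" "cadjoint T = T" "T ** swap_projector c = swap_projector c ** T"
    "T ** swap_projector c = M ** swap_projector c"
proof -
  let ?R = "swap_projector c :: ('a \<times> 'a) op"
  obtain X Y where XY: "X \<in> tensor_square \<A>" "Y \<in> tensor_square \<A>" "M = X + Swap ** Y"
    using schur_weyl[OF vN M MS] .
  note vN2 = von_neumann_algebra_tensor_square[OF vN]
  define sym where "sym Z = cscale (1/2) (Z + Swap ** Z ** Swap)" for Z :: "('a \<times> 'a) op"
  have sym_in: "sym Z \<in> tensor_square \<A>" if "Z \<in> tensor_square \<A>" for Z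
    unfolding sym_def using that by (intro vN_cscale[OF vN2] vN_add[OF vN2] Swap_conj_tensor_square)
  have sym_comm: "sym Z ** Swap = Swap ** sym Z" for Z
    by (simp add: sym_def mm_simps mult_Swap_Swap Swap_Swap_mult matrix_mul_assoc Swap_Swap add.commute)
  have "Swap ** M ** Swap = M"
    by (simp add: mult_Swap_Swap flip: MS)
  then have "M = sym M"
    by (simp only: sym_def cscale_half_double)
  also have "\<dots> = sym X + Swap ** sym Y"
    by (simp add: sym_def XY mm_simps matrix_mul_assoc algebra_simps)
  finally have M_eq: "M = sym X + sym Y ** Swap"
    by (simp add: sym_comm)
  define K where "K = sym X + cscale c (sym Y)"
  have K: "K \<in> tensor_square \<A>"
    unfolding K_def using XY by (intro vN_add[OF vN2] vN_cscale[OF vN2] sym_in)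
  have KR: "K ** ?R = M ** ?R"
    by (simp add: K_def M_eq mm_simps Swap_swap_projector flip: matrix_mul_assoc)
  have RK: "K ** ?R = ?R ** K"
    by (rule swap_projector_commute) (simp add: K_def mm_simps sym_comm)
  have "?R ** cadjoint K = cadjoint K ** ?R"
    using arg_cong[OF RK, of cadjoint] by (simp add: cadjoint_mult cadjoint_swap_projector)
  moreover have "?R ** cadjoint K = M ** ?R"
    using arg_cong[OF KR, of cadjoint] swap_projector_commute[OF MS]
    by (simp add: cadjoint_mult cadjoint_swap_projector Mh)
  ultimately have Ka: "cadjoint K ** ?R = M ** ?R" "?R ** cadjoint K = M ** ?R"
    by simp_all
  show ?thesis
  proof (rule that[of "cscale (1/2) (K + cadjoint K)"])
    show "cscale (1/2) (K + cadjoint K) \<in> tensor_square \<A>"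
      using K by (intro vN_cscale[OF vN2] vN_add[OF vN2] vN_adjoint[OF vN2])
    show "cadjoint (cscale (1/2) (K + cadjoint K)) = cscale (1/2) (K + cadjoint K)"
      by (simp add: cadjoint_simps add.commute)
    show "cscale (1/2) (K + cadjoint K) ** ?R = ?R ** cscale (1/2) (K + cadjoint K)"
      by (simp add: mm_cscale_left mm_cscale_right mm_add_left matrix_add_ldistrib Ka flip: RK)
    show "cscale (1/2) (K + cadjoint K) ** ?R = M ** ?R"
      by (simp only: mm_cscale_left mm_add_left Ka KR cscale_half_double)
  qed
qed

text \<open>Off the range of the projector \<open>P\<close> of \<open>compression_lift\<close>, any POVM with scalar values
  completes the lifted operators to a POVM.\<close>

lemma lift_swap_block:
  assumes vN: "von_neumann_algebra \<A>"
  obtains F where "linear F" "F (mat 1) = mat 1"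
    "\<And>M. M \<in> commutant (collective (gauge_group \<A>)) \<Longrightarrow> M ** Swap = Swap ** M \<Longrightarrow> positive_op M \<Longrightarrow>
      positive_op (F M) \<and> F M \<in> tensor_square \<A> \<and>
      swap_projector c ** F M ** swap_projector c = M ** swap_projector c"
proof -
  let ?R = "swap_projector c :: ('a \<times> 'a) op"
  note R = swap_projector_idem cadjoint_swap_projector
  note vN2 = von_neumann_algebra_tensor_square[OF vN]
  obtain P F where P: "P \<in> tensor_square \<A>" "P ** P = P" "cadjoint P = P" "P ** ?R = ?R"
    and F: "linear F" "\<And>T. T \<in> tensor_square \<A> \<Longrightarrow> F (T ** ?R) = T ** P"
      "\<And>T. T \<in> tensor_square \<A> \<Longrightarrow> cadjoint T = T \<Longrightarrow> T ** ?R = ?R ** T \<Longrightarrow> positive_op (T ** ?R) \<Longrightarrow>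
        positive_op (T ** P)"
    using compression_lift[OF vN2 R] by metis
  \<comment> \<open>Any unit vector serves: \<open>e \<bullet> (X *v e)\<close> is real linear in
    \<open>X\<close>, nonnegative for positive \<open>X\<close> and \<open>1\<close> at
    \<open>mat 1\<close>.\<close>
  define e :: "complex^('a \<times> 'a)" where "e = axis undefined 1"
  define G where "G X = F (X ** ?R) + (e \<bullet> (X *v e)) *\<^sub>R (mat 1 - P)" for X
  have ee: "e \<bullet> e = 1"
    by (simp add: e_def inner_axis_axis)
  have "linear (\<lambda>X :: ('a \<times> 'a) op. e \<bullet> (X *v e))"
    by (rule linearI) (simp_all add: matrix_vector_mult_add_rdistrib inner_add_right
        scaleR_mult_vec)
  from linear_compose[OF this, of "\<lambda>r. r *\<^sub>R (mat 1 - P)"]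
  have "linear (\<lambda>X :: ('a \<times> 'a) op. (e \<bullet> (X *v e)) *\<^sub>R (mat 1 - P))"
    by (simp add: linear_iff o_def algebra_simps)
  moreover have "linear (\<lambda>X. F (X ** ?R))"
    using linear_compose[OF linear_mm_right F(1)] by (simp add: o_def)
  ultimately have G: "linear G"
    unfolding G_def by (rule linear_compose_add[rotated])
  have "F ?R = P"
    using F(2)[OF vN_1[OF vN2]] by simp
  then have G1: "G (mat 1) = mat 1"
    by (simp add: G_def ee)
  have P': "mat 1 - P \<in> tensor_square \<A>" "positive_op (mat 1 - P)"
    using vN2 P by (auto simp: vN_diff vN_1 intro!: positive_op_projection)
      (simp_all add: mm_simps cadjoint_simps)
  show ?thesis
  proof (rule that[OF G G1])
    fix M assume M: "M \<in> commutant (collective (gauge_group \<A>))" "M ** Swap = Swap ** M" and pos: "positive_op M"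
    obtain T where T: "T \<in> tensor_square \<A>" "cadjoint T = T" "T ** ?R = ?R ** T" "T ** ?R = M ** ?R"
      using tensor_square_representative[OF vN M positive_op_hermitian[OF pos]] .
    have GM: "G M = T ** P + (e \<bullet> (M *v e)) *\<^sub>R (mat 1 - P)"
      using F(2)[OF T(1)] T(4) by (simp add: G_def)
    have "T ** ?R = conj_by ?R M"
      using T(4) swap_projector_commute[OF M(2)]
      by (simp add: conj_by_def R) (metis R(1) matrix_mul_assoc)
    then have "positive_op (T ** ?R)"
      using pos by (simp add: positive_op_conj_by)
    then have "positive_op (T ** P)"
      using F(3) T by blast
    then have "positive_op (G M)"
      unfolding GM using P'(2) positive_op_inner_nonneg[OF pos]
      by (intro positive_op_add positive_op_scaleR)
    moreover have "G M \<in> tensor_square \<A>"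
      unfolding GM scaleR_eq_cscale
      by (intro vN_add[OF vN2] vN_cscale[OF vN2] vN_mult[OF vN2] P' P T)
    moreover have "?R ** G M ** ?R = M ** ?R"
    proof -
      have "G M ** ?R = T ** (P ** ?R)"
        unfolding GM by (simp add: mm_add_left scaleR_eq_cscale mm_cscale_left mm_diff_left P matrix_mul_assoc)
          (simp add: P flip: matrix_mul_assoc)
      then have "?R ** G M ** ?R = ?R ** (T ** ?R)"
        by (simp add: P flip: matrix_mul_assoc)
      also have "\<dots> = T ** ?R"
        by (simp add: T(3) matrix_mul_assoc R)
      finally show ?thesis
        by (simp add: T(4))
    qed
    ultimately show "positive_op (G M) \<and> G M \<in> tensor_square \<A> \<and> ?R ** G M ** ?R = M ** ?R"
      by blast
  qed
qed

end

section \<open>Estimation statistics\<close>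

lemma norm_vec_le_sum: "norm x \<le> (\<Sum>i\<in>UNIV. norm (x $ i))"
  by (simp add: norm_vec_def L2_set_le_sum)

text \<open>A crude bound that makes the average state integrable. Positivity at
  \<open>axis i 1 + c *s axis j 1\<close> for the four fourth roots of unity \<open>c\<close> bounds
  the real and imaginary parts of each entry by 1, hence each entry by 2.\<close>

lemma norm_density_operator_le:
  fixes \<rho> :: "('n::finite) op"
  assumes "\<rho> \<in> density_operators"
  shows "norm \<rho> \<le> 2 * (real CARD('n))\<^sup>2"
proof -
  have pos: "positive_op \<rho>" and tr: "trace \<rho> = 1"
    using assms by (auto simp: density_operators_def)
  have h: "cnj (\<rho> $ j $ i) = \<rho> $ i $ j" for i j
    using positive_op_hermitian[OF pos] by (simp add: cadjoint_def vec_eq_iff)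
  have diag: "0 \<le> Re (\<rho> $ i $ i)" for i
    using positive_op_inner_nonneg[OF pos, of "axis i 1"]
    by (simp add: inner_axis' mult_vec_axis inner_complex_def)
  have diag_le: "Re (\<rho> $ i $ i) \<le> 1" for i
  proof -
    have "Re (\<rho> $ i $ i) \<le> (\<Sum>i\<in>UNIV. Re (\<rho> $ i $ i))"
      using diag by (intro member_le_sum) auto
    also have "\<dots> = 1"
      using arg_cong[OF tr, of Re] by (simp add: trace_def)
    finally show ?thesis .
  qed
  have bound: "- 1 \<le> Re (c * \<rho> $ i $ j)" if c: "cnj c * c = 1" for c i j
  proof -
    define v where "v = axis i 1 + c *s axis j (1 :: complex)"
    have "0 \<le> Re (cinner v (\<rho> *v v))"
      using positive_op_inner_nonneg[OF pos] by (simp add: Re_cinner)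
    also have "cinner v (\<rho> *v v) = \<rho> $ i $ i + c * \<rho> $ i $ j + cnj c * \<rho> $ j $ i + cnj c * c * \<rho> $ j $ j"
      by (simp add: v_def matrix_vector_right_distrib vector_scalar_commute cinner_add_left
          cinner_add_right cinner_scale_left cinner_scale_right cinner_axis mult_vec_axis algebra_simps)
    also have "cnj c * \<rho> $ j $ i = cnj (c * \<rho> $ i $ j)"
      by (simp add: h)
    finally have "0 \<le> Re (\<rho> $ i $ i) + 2 * Re (c * \<rho> $ i $ j) + Re (\<rho> $ j $ j)"
      unfolding c by simp
    then show ?thesis
      using diag_le[of i] diag_le[of j] by linarith
  qed
  have entry: "norm (\<rho> $ i $ j) \<le> 2" for i j
    using bound[of 1 i j] bound[of "-1" i j] bound[of \<i> i j] bound[of "-\<i>" i j]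
      cmod_le[of "\<rho> $ i $ j"] by simp
  have "norm (\<rho> $ i) \<le> (\<Sum>j\<in>(UNIV :: 'n set). 2)" for i
    by (rule order_trans[OF norm_vec_le_sum sum_mono]) (rule entry)
  then have "norm \<rho> \<le> (\<Sum>i\<in>(UNIV :: 'n set). \<Sum>j\<in>(UNIV :: 'n set). 2)"
    by (rule order_trans[OF norm_vec_le_sum sum_mono])
  then show ?thesis
    by (simp add: power2_eq_square)
qed

lemma conj_by_density_operators:
  assumes "unitary V" "\<rho> \<in> density_operators"
  shows "conj_by V \<rho> \<in> density_operators"
proof -
  have "trace (conj_by V \<rho>) = trace (cadjoint V ** V ** \<rho>)"
    unfolding conj_by_def by (subst trace_mul_sym) (simp add: matrix_mul_assoc)
  then show ?thesis
    using assms by (simp add: density_operators_def positive_op_conj_by unitary_def)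
qed

lemma linear_conj_by: "linear (conj_by V)"
  using linear_compose[OF linear_mm_left[of V] linear_mm_right[of "cadjoint V"]]
  by (simp add: conj_by_def[abs_def] o_def)

lemma linear_trace_mult: "linear (\<lambda>\<rho>. trace (X ** \<rho>))" for X :: "('n::finite) op"
  by (rule linearI) (simp_all add: matrix_add_ldistrib trace_add scaleR_eq_cscale mm_cscale_right,
      simp add: trace_def cscale_def sum_distrib_left scaleR_conv_of_real)

text \<open>Orthogonality for \<open>\<bullet>\<close> only controls real parts of traces; the
  imaginary part follows by using \<open>cscale \<i> R\<close>, also in the commutant.\<close>

lemma trace_mult_eq_orth_proj:
  assumes H: "\<And>X. X \<in> H \<Longrightarrow> cadjoint X \<in> H" and R: "R \<in> commutant H"
  shows "trace (orth_proj (commutant H) X ** R) = trace (X ** R)"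
proof -
  note vN = von_neumann_algebra_commutant[OF H]
  define Z where "Z = X - orth_proj (commutant H) X"
  have Re: "Re (trace (Y ** Z)) = 0" if "Y \<in> commutant H" for Y
    using orth_proj_orth[OF subspace_of_cmat_subspace[OF vN_subspace[OF vN]] vN_adjoint[OF vN that]]
    by (simp add: Re_trace_mult Z_def inner_commute)
  have "trace (cscale \<i> R ** Z) = \<i> * trace (R ** Z)"
    by (simp add: mm_cscale_left) (simp add: trace_def cscale_def sum_distrib_left)
  then have "trace (R ** Z) = 0"
    using Re[OF R] Re[OF vN_cscale[OF vN R, of \<i>]] by (simp add: complex_eq_iff)
  then have "trace (Z ** R) = 0"
    by (simp add: trace_mul_sym[of R Z])
  moreover have "trace (X ** R) = trace (Z ** R) + trace (orth_proj (commutant H) X ** R)"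
    by (simp add: Z_def flip: trace_add mm_add_left)
  ultimately show ?thesis
    by simp
qed

text \<open>Both sides are traces against the average state \<open>R\<close>, which commutes with the symmetries.
  A nonzero probability of the parameter region entails its measurability.\<close>

lemma cond_outcome_prob_orth_proj:
  fixes \<mu> :: "('n::finite) op measure" and M M' :: "'w set \<Rightarrow> 'n op"
  assumes \<mu>: "invariant_reference_measure \<mu>" and p: "probability_density \<mu> p"
    and H: "\<And>X. X \<in> H \<Longrightarrow> unitary X" "\<And>X. X \<in> H \<Longrightarrow> cadjoint X \<in> H"
    and sym: "prior_symmetry H p" "parameter_symmetry H p s"
    and \<Delta>: "parameter_prob \<mu> p s \<Delta> \<noteq> 0"
    and M': "M' B = orth_proj (commutant H) (M B)"
  shows "cond_outcome_prob \<mu> p s M B \<Delta> = cond_outcome_prob \<mu> p s M' B \<Delta>"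
proof -
  define D where "D = {\<rho>\<in>supp p. s \<rho> \<in> \<Delta>}"
  define w where "w \<rho> = indicator D \<rho> * p \<rho>" for \<rho>
  have sets: "sets \<mu> = sets (restrict_space borel density_operators)"
    and inv: "\<And>V. unitary V \<Longrightarrow> distr \<mu> \<mu> (conj_by V) = \<mu>"
    using \<mu> by (auto simp: invariant_reference_measure_def)
  have space: "space \<mu> = density_operators"
    using sets_eq_imp_space_eq[OF sets] by (simp add: space_restrict_space)
  have "parameter_prob \<mu> p s \<Delta> = integral\<^sup>L \<mu> w"
    by (simp add: parameter_prob_def set_lebesgue_integral_def D_def w_def[abs_def])
  \<comment> \<open>A function that is not integrable has integral \<open>0\<close> by
    convention.\<close>
  then have "integrable \<mu> w"
    using \<Delta> not_integrable_integral_eq[of \<mu> w] by auto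
  have id_meas: "(\<lambda>\<rho>. \<rho>) \<in> borel_measurable \<mu>"
    unfolding measurable_cong_sets[OF sets refl]
    by (intro measurable_restrict_space1 measurable_ident_sets refl)
  have meas: "(\<lambda>\<rho>. w \<rho> *\<^sub>R \<rho>) \<in> borel_measurable \<mu>"
    using \<open>integrable \<mu> w\<close> id_meas by (intro borel_measurable_scaleR) auto
  have int: "integrable \<mu> (\<lambda>\<rho>. w \<rho> *\<^sub>R \<rho>)"
  proof (rule Bochner_Integration.integrable_bound[OF _ meas AE_I2])
    show "integrable \<mu> (\<lambda>\<rho>. 2 * (real CARD('n))\<^sup>2 * w \<rho>)"
      using \<open>integrable \<mu> w\<close> by simp
    show "norm (w \<rho> *\<^sub>R \<rho>) \<le> norm (2 * (real CARD('n))\<^sup>2 * w \<rho>)" if "\<rho> \<in> space \<mu>" for \<rho>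
      using mult_left_mono[OF norm_density_operator_le, of \<rho> "\<bar>w \<rho>\<bar>"] that
      by (simp add: space abs_mult mult.commute)
  qed
  define R where "R = (\<integral>\<rho>. w \<rho> *\<^sub>R \<rho> \<partial>\<mu>)"
  have bl: "bounded_linear f" if "linear f" for f :: "'n op \<Rightarrow> 'z::real_normed_vector"
    using that by (simp add: linear_conv_bounded_linear)
  \<comment> \<open>A change of variables, since both the weight \<open>w\<close> and the measure
    are invariant under \<open>conj_by V\<close>.\<close>
  have "conj_by V R = R" if V: "V \<in> H" for V
  proof -
    have w_conj: "w (conj_by V \<rho>) = w \<rho>" if \<rho>: "\<rho> \<in> space \<mu>" for \<rho>
    proof -
      have "p (conj_by V \<rho>) = p \<rho>"
        using sym(1) V \<rho> by (auto simp: prior_symmetry_def space)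
      moreover have "conj_by V \<rho> \<in> density_operators"
        using conj_by_density_operators[OF H(1)[OF V]] \<rho> by (simp add: space)
      ultimately have "conj_by V \<rho> \<in> supp p \<longleftrightarrow> \<rho> \<in> supp p"
        using \<rho> by (simp add: supp_def space)
      moreover have "s (conj_by V \<rho>) = s \<rho>" if "\<rho> \<in> supp p"
        using sym(2) V that by (auto simp: parameter_symmetry_def)
      ultimately show ?thesis
        using \<open>p (conj_by V \<rho>) = p \<rho>\<close> by (auto simp: w_def D_def indicator_def)
    qed
    have "conj_by V \<in> measurable (restrict_space borel density_operators)
        (restrict_space borel density_operators)"
      using conj_by_density_operators[OF H(1)[OF V]]
      by (intro measurable_restrict_space3 borel_measurable_continuous_onI linear_continuous_on
          bl linear_conj_by) auto
    then have cm: "conj_by V \<in> measurable \<mu> \<mu>"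
      by (simp add: measurable_cong_sets[OF sets sets])
    have "conj_by V R = (\<integral>\<rho>. conj_by V (w \<rho> *\<^sub>R \<rho>) \<partial>\<mu>)"
      unfolding R_def by (rule integral_bounded_linear[OF bl[OF linear_conj_by] int, symmetric])
    also have "\<dots> = (\<integral>\<rho>. w (conj_by V \<rho>) *\<^sub>R conj_by V \<rho> \<partial>\<mu>)"
      by (rule Bochner_Integration.integral_cong) (simp_all add: linear_scale[OF linear_conj_by] w_conj)
    also have "\<dots> = (\<integral>\<rho>. w \<rho> *\<^sub>R \<rho> \<partial>(distr \<mu> \<mu> (conj_by V)))"
      by (rule integral_distr[OF cm meas, symmetric])
    finally show ?thesis
      by (simp add: inv H(1)[OF V] R_def)
  qed
  then have "R ** V = V ** R" if "V \<in> H" for V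
    using that H(1)[OF that] unfolding conj_by_def unitary_def
    by (metis matrix_mul_assoc matrix_mul_rid)
  then have RH: "R \<in> commutant H"
    by (rule commutantI)
  have "(LINT \<rho>:D|\<mu>. complex_of_real (p \<rho>) * outcome_prob N B \<rho>) = trace (N B ** R)" for N :: "'w set \<Rightarrow> 'n op"
  proof -
    have "(LINT \<rho>:D|\<mu>. complex_of_real (p \<rho>) * outcome_prob N B \<rho>) =
        (\<integral>\<rho>. trace (N B ** (w \<rho> *\<^sub>R \<rho>)) \<partial>\<mu>)"
      unfolding set_lebesgue_integral_def linear_scale[OF linear_trace_mult]
      by (simp add: w_def outcome_prob_def scaleR_conv_of_real mult.assoc)
    also have "\<dots> = trace (N B ** R)"
      unfolding R_def by (rule integral_bounded_linear[OF bl[OF linear_trace_mult] int])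
    finally show ?thesis .
  qed
  then show ?thesis
    by (simp add: cond_outcome_prob_def M' trace_mult_eq_orth_proj[OF H(2) RH] flip: D_def)
qed

theorem theorem17:
  fixes \<A> :: "('d::finite) op set"
    and \<mu> :: "('d \<times> 'd) op measure"
    and p :: "('d \<times> 'd) op \<Rightarrow> real"
    and s :: "('d \<times> 'd) op \<Rightarrow> real^('l::finite)"
    and \<Omega> :: "'w set" and \<Sigma> :: "'w set set"
    and M :: "'w set \<Rightarrow> ('d \<times> 'd) op"
  assumes "von_neumann_algebra \<A>"
    and "invariant_reference_measure \<mu>"
    and "probability_density \<mu> p"
    and "s \<in> borel_measurable (restrict_space \<mu> (supp p))"
    and "prior_symmetry (collective (gauge_group \<A>)) p"
    and "parameter_symmetry (collective (gauge_group \<A>)) p s"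
    and "prior_symmetry permutation_group p"
    and "parameter_symmetry permutation_group p s"
    and "sigma_algebra \<Omega> \<Sigma>"
    and "POVM \<Omega> \<Sigma> M"
  shows "\<exists>M' M\<^sub>p M\<^sub>m.
     POVM \<Omega> \<Sigma> M' \<and> POVM \<Omega> \<Sigma> M\<^sub>p \<and> POVM \<Omega> \<Sigma> M\<^sub>m \<and>
     (\<forall>B\<in>\<Sigma>. M\<^sub>p B \<in> tensor_square \<A> \<and> M\<^sub>m B \<in> tensor_square \<A>) \<and>
     (\<forall>B\<in>\<Sigma>. M' B = Pi_plus ** M\<^sub>p B ** Pi_plus + Pi_minus ** M\<^sub>m B ** Pi_minus) \<and>
     (\<forall>B\<in>\<Sigma>. \<forall>\<Delta>. is_interval \<Delta> \<and> parameter_prob \<mu> p s \<Delta> \<noteq> 0 \<longrightarrow>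
        cond_outcome_prob \<mu> p s M B \<Delta> = cond_outcome_prob \<mu> p s M' B \<Delta>)"
proof -
  note vN = assms(1)
  \<comment> \<open>The other permutation, \<open>mat 1\<close>, commutes with everything and
    imposes no condition.\<close>
  define H where "H = collective (gauge_group \<A>) \<union> {Swap}"
  have H_unitary: "unitary X" if "X \<in> H" for X
    using that unitary_Swap
    by (auto simp: H_def collective_def gauge_group_def unitary_def cadjoint_tensor_op
        tensor_op_mult tensor_op_1)
  have adjoint_gauge: "cadjoint V \<in> gauge_group \<A>" if V: "V \<in> gauge_group \<A>" for V
  proof -
    have "cadjoint V ** X = X ** cadjoint V" if "X \<in> \<A>" for X
    proof -
      have "V ** cadjoint X = cadjoint X ** V"
        using V vN_adjoint[OF vN that] by (simp add: gauge_group_def)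
      from arg_cong[OF this, of cadjoint] show ?thesis
        by (simp add: cadjoint_mult)
    qed
    then show ?thesis
      using V by (simp add: gauge_group_def unitary_def)
  qed
  have H_adjoint: "cadjoint X \<in> H" if "X \<in> H" for X
    using that adjoint_gauge by (auto simp: H_def collective_def cadjoint_Swap cadjoint_tensor_op)
  have H_sym: "prior_symmetry H p" "parameter_symmetry H p s"
    using assms(5-8) by (auto simp: H_def prior_symmetry_def parameter_symmetry_def permutation_group_def)
  define E where "E = orth_proj (commutant H)"
  note vNH = von_neumann_algebra_commutant[OF H_adjoint]
  note sH = subspace_of_cmat_subspace[OF vN_subspace[OF vNH]]
  have E: "linear E" "E (mat 1) = mat 1"
    unfolding E_def by (simp_all add: linear_orth_proj sH orth_proj_id vN_1[OF vNH])
  have EM: "E (M B) \<in> commutant (collective (gauge_group \<A>))" "E (M B) ** Swap = Swap ** E (M B)"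
      "positive_op (E (M B))" if "B \<in> \<Sigma>" for B
  proof -
    have "E (M B) \<in> commutant H"
      unfolding E_def by (rule orth_proj_in[OF sH])
    then show "E (M B) \<in> commutant (collective (gauge_group \<A>))" "E (M B) ** Swap = Swap ** E (M B)"
      by (auto simp: commutant_def H_def)
    show "positive_op (E (M B))"
      using assms(10) that H_adjoint unfolding E_def
      by (intro positive_op_orth_proj_commutant) (auto simp: POVM_def)
  qed
  have POVM_E: "POVM \<Omega> \<Sigma> (\<lambda>B. E (M B))"
    by (rule POVM_linear_image[OF assms(10) E EM(3)])
  obtain F where F: "linear F" "F (mat 1) = mat 1"
    "\<And>M. M \<in> commutant (collective (gauge_group \<A>)) \<Longrightarrow> M ** Swap = Swap ** M \<Longrightarrow> positive_op M \<Longrightarrow>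
      positive_op (F M) \<and> F M \<in> tensor_square \<A> \<and> Pi_plus ** F M ** Pi_plus = M ** Pi_plus"
    using lift_swap_block[of 1, OF _ vN] unfolding Pi_plus_swap_projector by blast
  obtain G where G: "linear G" "G (mat 1) = mat 1"
    "\<And>M. M \<in> commutant (collective (gauge_group \<A>)) \<Longrightarrow> M ** Swap = Swap ** M \<Longrightarrow> positive_op M \<Longrightarrow>
      positive_op (G M) \<and> G M \<in> tensor_square \<A> \<and> Pi_minus ** G M ** Pi_minus = M ** Pi_minus"
    using lift_swap_block[of "-1", OF _ vN] unfolding Pi_minus_swap_projector by blast
  show ?thesis
  proof (rule exI[of _ "\<lambda>B. E (M B)"], rule exI[of _ "\<lambda>B. F (E (M B))"],
      rule exI[of _ "\<lambda>B. G (E (M B))"], intro conjI ballI allI impI)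
    show "POVM \<Omega> \<Sigma> (\<lambda>B. E (M B))"
      by (rule POVM_E)
    show "POVM \<Omega> \<Sigma> (\<lambda>B. F (E (M B)))"
      by (rule POVM_linear_image[OF POVM_E F(1,2)]) (simp add: F(3) EM)
    show "POVM \<Omega> \<Sigma> (\<lambda>B. G (E (M B)))"
      by (rule POVM_linear_image[OF POVM_E G(1,2)]) (simp add: G(3) EM)
    fix B assume B: "B \<in> \<Sigma>"
    show "F (E (M B)) \<in> tensor_square \<A>" "G (E (M B)) \<in> tensor_square \<A>"
      by (simp_all add: F(3) G(3) EM B)
    \<comment> \<open>Each term is \<open>E (M B)\<close> times its projector, and the projectors
      add up to \<open>mat 1\<close>.\<close>
    show "E (M B) = Pi_plus ** F (E (M B)) ** Pi_plus + Pi_minus ** G (E (M B)) ** Pi_minus"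
      using F(3)[OF EM[OF B]] G(3)[OF EM[OF B]]
      by (simp add: Pi_plus_add_Pi_minus flip: matrix_add_ldistrib)
    fix \<Delta> :: "(real^'l) set" assume "is_interval \<Delta> \<and> parameter_prob \<mu> p s \<Delta> \<noteq> 0"
    then have "parameter_prob \<mu> p s \<Delta> \<noteq> 0" ..
    with assms(2,3) H_unitary H_adjoint H_sym
    show "cond_outcome_prob \<mu> p s M B \<Delta> = cond_outcome_prob \<mu> p s (\<lambda>B. E (M B)) B \<Delta>"
      by (rule cond_outcome_prob_orth_proj) (simp_all add: E_def)
  qed
qed

end
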